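(* Let $A$ be a weak bialgebra with pre-antipode $S$ and assume $S$ is a bialgebra anti-morphism. Then the following statements are equivalent: (i) $S$ is an antipode and $A$ is a weak Hopf algebra; (ii) $A$ is bimonoidal; (iii) $A$ is right-monoidal and right-comonoidal; (iv) $[A_L,A_R]=0$; (v) $[\hat A_L,\hat A_R]=0$.
   Context: $K$ is a field and all spaces are finite dimensional over $K$. A weak bialgebra $(A,1,\Delta,\varepsilon)$ is a unital associative $K$-algebra $(A,1)$ which is also a coassociative coalgebra with coproduct $\Delta$ and counit $\varepsilon$, such that $\Delta(ab)=\Delta(a)\Delta(b)$ for all $a,b$; neither $\Delta(1)=1\otimes1$ nor multiplicativity of $\varepsilon$ is required. Sweedler notation is used. The dual $\hat A=\mathrm{Hom}_K(A,K)$ is an algebra with product $\langle\phi\psi\mid a\rangle=\langle\phi\otimes\psi\mid\Delta(a)\rangle$ and unit $\varepsilon$. $A$ is left-monoidal if $\varepsilon(abc)=\varepsilon(ab_{(1)})\varepsilon(b_{(2)}c)$ and right-monoidal if $\varepsilon(abc)=\varepsilon(ab_{(2)})\varepsilon(b_{(1)}c)$ for all $a,b,c$; left-comonoidal if $(\Delta(1)\otimes1)(1\otimes\Delta(1))=1_{(1)}\otimes1_{(2)}\otimes1_{(3)}$ and right-comonoidal if $(1\otimes\Delta(1))(\Delta(1)\otimes1)=1_{(1)}\otimes1_{(2)}\otimes1_{(3)}$. Bimonoidal means that all four conditions hold. A pre-antipode is a linear map $S:A\to A$ with $a_{(1)}S(a_{(2)})=\varepsilon(1_{(1)}a)1_{(2)}$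 and $S(a_{(1)})a_{(2)}=1_{(1)}\varepsilon(a1_{(2)})$ for all $a$; it is an antipode if also $S(a_{(1)})a_{(2)}S(a_{(3)})=S(a)$ for all $a$. A weak Hopf algebra is a bimonoidal weak bialgebra with antipode. $S$ is a bialgebra anti-morphism if $S(ab)=S(b)S(a)$ and $\Delta(S(a))=S(a_{(2)})\otimes S(a_{(1)})$ for all $a,b$ (for a pre-antipode this implies $S(1)=1$ and $\varepsilon\circ S=\varepsilon$). $A_L=\{\langle\phi\mid1_{(1)}\rangle1_{(2)}:\phi\in\hat A\}$, $A_R=\{1_{(1)}\langle\phi\mid1_{(2)}\rangle:\phi\in\hat A\}$, and $\hat A_L=\{\varepsilon(a\,\cdot\,):a\in A\}$, $\hat A_R=\{\varepsilon(\,\cdot\,a):a\in A\}$ as subspaces of $\hat A$. $[X,Y]=0$ means $xy=yx$ for all $x\in X,y\in Y$. *)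

theory Defs
  imports Complex_Main "HOL-Library.Function_Algebras"
begin

text \<open>
  The tensor powers of a finite dimensional space \<open>A\<close> over a field \<open>K\<close> are realised as the
  spaces of linear functionals on multilinear forms: \<open>x \<otimes> y\<close> is evaluation \<open>F \<mapsto> F x y\<close> on
  bilinear forms \<open>F : A \<times> A \<rightarrow> K\<close>, and \<open>A \<otimes> A\<close> consists of the finite sums of such
  evaluations; likewise for \<open>A \<otimes> A \<otimes> A\<close> and trilinear forms.  Functionals are set to 0 on
  functions that are not multilinear, so that equality of tensors is equality in HOL.
  The lemmas below establish the universal property of these spaces.
\<close>

type_synonym ('k, 'a) tensor2 = "('a \<Rightarrow> 'a \<Rightarrow> 'k) \<Rightarrow> 'k"
type_synonym ('k, 'a) tensor3 = "('a \<Rightarrow> 'a \<Rightarrow> 'a \<Rightarrow> 'k) \<Rightarrow> 'k"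

definition tensor_scale :: "'k::field \<Rightarrow> ('f \<Rightarrow> 'k) \<Rightarrow> 'f \<Rightarrow> 'k" where
  "tensor_scale c t = (\<lambda>F. c * t F)"

lemma vector_space_field: "vector_space ((*) :: 'k::field \<Rightarrow> 'k \<Rightarrow> 'k)"
  by unfold_locales (simp_all add: algebra_simps)

lemma vector_space_tensor_scale: "vector_space (tensor_scale :: 'k::field \<Rightarrow> ('f \<Rightarrow> 'k) \<Rightarrow> _)"
  by unfold_locales (simp_all add: tensor_scale_def fun_eq_iff algebra_simps)

text \<open>
  The sort \<open>{ring, monoid_mult}\<close> is that of unital associative rings in which \<open>0 = 1\<close> is not
  excluded (unlike class \<open>ring_1\<close>), so the zero algebra is covered.
\<close>

locale fd_algebra = vector_space scale
  for scale :: "'k::field \<Rightarrow> 'a::{ring, monoid_mult} \<Rightarrow> 'a" (infixr "*s" 75) +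
  assumes finite_dim: "\<exists>B. finite B \<and> span B = UNIV"
    and scale_mult_left: "(c *s a) * b = c *s (a * b)"
    and scale_mult_right: "a * (c *s b) = c *s (a * b)"
begin

definition linear_form :: "('a \<Rightarrow> 'k) \<Rightarrow> bool" where
  "linear_form \<phi> \<longleftrightarrow> Vector_Spaces.linear scale (*) \<phi>"

definition bilinear_map :: "('k \<Rightarrow> 'b::ab_group_add \<Rightarrow> 'b) \<Rightarrow> ('a \<Rightarrow> 'a \<Rightarrow> 'b) \<Rightarrow> bool" where
  "bilinear_map s F \<longleftrightarrow>
     (\<forall>y. Vector_Spaces.linear scale s (\<lambda>x. F x y)) \<and>
     (\<forall>x. Vector_Spaces.linear scale s (\<lambda>y. F x y))"

definition trilinear_map :: "('k \<Rightarrow> 'b::ab_group_add \<Rightarrow> 'b) \<Rightarrow> ('a \<Rightarrow> 'a \<Rightarrow> 'a \<Rightarrow> 'b) \<Rightarrow> bool" where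
  "trilinear_map s F \<longleftrightarrow>
     (\<forall>y z. Vector_Spaces.linear scale s (\<lambda>x. F x y z)) \<and>
     (\<forall>x z. Vector_Spaces.linear scale s (\<lambda>y. F x y z)) \<and>
     (\<forall>x y. Vector_Spaces.linear scale s (\<lambda>z. F x y z))"

definition tens2 :: "'a \<Rightarrow> 'a \<Rightarrow> ('k, 'a) tensor2" where
  "tens2 x y = (\<lambda>F. if bilinear_map (*) F then F x y else 0)"

definition tens3 :: "'a \<Rightarrow> 'a \<Rightarrow> 'a \<Rightarrow> ('k, 'a) tensor3" where
  "tens3 x y z = (\<lambda>F. if trilinear_map (*) F then F x y z else 0)"

definition tensor_space2 :: "('k, 'a) tensor2 set" where
  "tensor_space2 = {\<Sum>(x, y)\<leftarrow>xs. tens2 x y | xs. True}"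

text \<open>
  \<open>sweedler2 t f\<close> is the value at \<open>t \<in> A \<otimes> A\<close> of the linear map on \<open>A \<otimes> A\<close> induced by the
  bilinear map \<open>f\<close>; thus \<open>sweedler2 (\<Delta> a) (\<lambda>x y. f x y)\<close> is what Sweedler notation writes as
  \<open>f(a\<^sub>(\<^sub>1\<^sub>), a\<^sub>(\<^sub>2\<^sub>))\<close>.  Similarly for \<open>sweedler3\<close>.
\<close>

definition sweedler2 :: "('k, 'a) tensor2 \<Rightarrow> ('a \<Rightarrow> 'a \<Rightarrow> 'b::ab_group_add) \<Rightarrow> 'b" where
  "sweedler2 t f = (THE v. \<exists>xs. t = (\<Sum>(x, y)\<leftarrow>xs. tens2 x y) \<and> v = (\<Sum>(x, y)\<leftarrow>xs. f x y))"

definition sweedler3 :: "('k, 'a) tensor3 \<Rightarrow> ('a \<Rightarrow> 'a \<Rightarrow> 'a \<Rightarrow> 'b::ab_group_add) \<Rightarrow> 'b" where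
  "sweedler3 t f =
     (THE v. \<exists>xs. t = (\<Sum>(x, y, z)\<leftarrow>xs. tens3 x y z) \<and> v = (\<Sum>(x, y, z)\<leftarrow>xs. f x y z))"

definition mult2 :: "('k, 'a) tensor2 \<Rightarrow> ('k, 'a) tensor2 \<Rightarrow> ('k, 'a) tensor2" where
  "mult2 s t = sweedler2 s (\<lambda>x y. sweedler2 t (\<lambda>x' y'. tens2 (x * x') (y * y')))"

definition mult3 :: "('k, 'a) tensor3 \<Rightarrow> ('k, 'a) tensor3 \<Rightarrow> ('k, 'a) tensor3" where
  "mult3 s t =
     sweedler3 s (\<lambda>x y z. sweedler3 t (\<lambda>x' y' z'. tens3 (x * x') (y * y') (z * z')))"

lemma bilinear_map_tens2: "bilinear_map tensor_scale tens2"
  unfolding bilinear_map_def Vector_Spaces.linear_iff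
  by (auto simp: vector_space_axioms vector_space_tensor_scale tens2_def tensor_scale_def
      fun_eq_iff bilinear_map_def Vector_Spaces.linear_iff)

lemma trilinear_map_tens3: "trilinear_map tensor_scale tens3"
  unfolding trilinear_map_def Vector_Spaces.linear_iff
  by (auto simp: vector_space_axioms vector_space_tensor_scale tens3_def tensor_scale_def
      fun_eq_iff trilinear_map_def Vector_Spaces.linear_iff)

lemma linear_functionals_separate:
  fixes s :: "'k \<Rightarrow> 'b::ab_group_add \<Rightarrow> 'b"
  assumes "vector_space s" and eq: "\<And>\<phi>. Vector_Spaces.linear s (*) \<phi> \<Longrightarrow> \<phi> v = \<phi> w"
  shows "v = w"
proof (rule ccontr)
  assume "v \<noteq> w"
  interpret V: vector_space s by fact
  interpret P: vector_space_pair s "(*) :: 'k \<Rightarrow> 'k \<Rightarrow> 'k"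
    by (intro vector_space_pair.intro assms(1) vector_space_field)
  have "V.independent {v - w}" using \<open>v \<noteq> w\<close> by simp
  then obtain \<phi> where lin: "Vector_Spaces.linear s (*) \<phi>" and "\<phi> (v - w) = 1"
    using P.linear_independent_extend[of "{v - w}" "\<lambda>_. 1"] by auto
  then show False using eq[OF lin] P.linear_diff[OF lin, of v w] by simp
qed

lemma sum_list_fun_apply: "(\<Sum>p\<leftarrow>ps. g p) F = (\<Sum>p\<leftarrow>ps. g p F)"
  for g :: "'p \<Rightarrow> 'f \<Rightarrow> 'c::comm_monoid_add"
  by (induction ps) simp_all

lemma linear_sum_list:
  assumes "Vector_Spaces.linear s t \<phi>"
  shows "\<phi> (\<Sum>p\<leftarrow>ps. g p) = (\<Sum>p\<leftarrow>ps. \<phi> (g p))"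
proof -
  interpret Vector_Spaces.linear s t \<phi> by fact
  show ?thesis by (induction ps) (simp_all add: zero add)
qed

lemma sweedler2_sum:
  fixes s :: "'k \<Rightarrow> 'b::ab_group_add \<Rightarrow> 'b"
  assumes f: "bilinear_map s f"
  shows "sweedler2 (\<Sum>(x, y)\<leftarrow>xs. tens2 x y) f = (\<Sum>(x, y)\<leftarrow>xs. f x y)"
  unfolding sweedler2_def
proof (rule the_equality)
  fix v
  assume "\<exists>ys. (\<Sum>(x, y)\<leftarrow>xs. tens2 x y) = (\<Sum>(x, y)\<leftarrow>ys. tens2 x y) \<and>
    v = (\<Sum>(x, y)\<leftarrow>ys. f x y)"
  then obtain ys where eq: "(\<Sum>(x, y)\<leftarrow>xs. tens2 x y) = (\<Sum>(x, y)\<leftarrow>ys. tens2 x y)"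
    and v: "v = (\<Sum>(x, y)\<leftarrow>ys. f x y)" by blast
  have "vector_space s" using f by (auto simp: bilinear_map_def Vector_Spaces.linear_iff)
  then show "v = (\<Sum>(x, y)\<leftarrow>xs. f x y)"
  proof (rule linear_functionals_separate)
    fix \<phi> assume \<phi>: "Vector_Spaces.linear s (*) \<phi>"
    have "bilinear_map (*) (\<lambda>x y. \<phi> (f x y))"
      using f \<phi> by (auto simp: bilinear_map_def Vector_Spaces.linear_iff)
    then have "\<phi> (\<Sum>(x, y)\<leftarrow>zs. f x y) = (\<Sum>(x, y)\<leftarrow>zs. tens2 x y) (\<lambda>x y. \<phi> (f x y))" for zs
      by (simp add: linear_sum_list[OF \<phi>] sum_list_fun_apply tens2_def case_prod_unfold)
    then show "\<phi> v = \<phi> (\<Sum>(x, y)\<leftarrow>xs. f x y)" using eq v by simp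
  qed
qed blast

lemma sweedler3_sum:
  fixes s :: "'k \<Rightarrow> 'b::ab_group_add \<Rightarrow> 'b"
  assumes f: "trilinear_map s f"
  shows "sweedler3 (\<Sum>(x, y, z)\<leftarrow>xs. tens3 x y z) f = (\<Sum>(x, y, z)\<leftarrow>xs. f x y z)"
  unfolding sweedler3_def
proof (rule the_equality)
  fix v
  assume "\<exists>ys. (\<Sum>(x, y, z)\<leftarrow>xs. tens3 x y z) = (\<Sum>(x, y, z)\<leftarrow>ys. tens3 x y z) \<and>
    v = (\<Sum>(x, y, z)\<leftarrow>ys. f x y z)"
  then obtain ys where eq: "(\<Sum>(x, y, z)\<leftarrow>xs. tens3 x y z) = (\<Sum>(x, y, z)\<leftarrow>ys. tens3 x y z)"
    and v: "v = (\<Sum>(x, y, z)\<leftarrow>ys. f x y z)" by blast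
  have "vector_space s" using f by (auto simp: trilinear_map_def Vector_Spaces.linear_iff)
  then show "v = (\<Sum>(x, y, z)\<leftarrow>xs. f x y z)"
  proof (rule linear_functionals_separate)
    fix \<phi> assume \<phi>: "Vector_Spaces.linear s (*) \<phi>"
    have "trilinear_map (*) (\<lambda>x y z. \<phi> (f x y z))"
      using f \<phi> by (auto simp: trilinear_map_def Vector_Spaces.linear_iff)
    then have "\<phi> (\<Sum>(x, y, z)\<leftarrow>zs. f x y z) =
        (\<Sum>(x, y, z)\<leftarrow>zs. tens3 x y z) (\<lambda>x y z. \<phi> (f x y z))" for zs
      by (simp add: linear_sum_list[OF \<phi>] sum_list_fun_apply tens3_def case_prod_unfold)
    then show "\<phi> v = \<phi> (\<Sum>(x, y, z)\<leftarrow>xs. f x y z)" using eq v by simp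
  qed
qed blast

end

locale weak_bialgebra = fd_algebra scale
  for scale :: "'k::field \<Rightarrow> 'a::{ring, monoid_mult} \<Rightarrow> 'a" (infixr "*s" 75) +
  fixes \<Delta> :: "'a \<Rightarrow> ('k, 'a) tensor2" and \<epsilon> :: "'a \<Rightarrow> 'k"
  assumes comult_in: "\<Delta> a \<in> tensor_space2"
    and comult_linear: "Vector_Spaces.linear scale tensor_scale \<Delta>"
    and counit_linear: "linear_form \<epsilon>"
    and coassoc: "sweedler2 (\<Delta> a) (\<lambda>x y. sweedler2 (\<Delta> x) (\<lambda>u v. tens3 u v y)) =
                  sweedler2 (\<Delta> a) (\<lambda>x y. sweedler2 (\<Delta> y) (\<lambda>u v. tens3 x u v))"
    and counit_left: "sweedler2 (\<Delta> a) (\<lambda>x y. \<epsilon> x *s y) = a"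
    and counit_right: "sweedler2 (\<Delta> a) (\<lambda>x y. \<epsilon> y *s x) = a"
    and comult_mult: "\<Delta> (a * b) = mult2 (\<Delta> a) (\<Delta> b)"
begin

text \<open>The iterated coproduct \<open>a \<mapsto> a\<^sub>(\<^sub>1\<^sub>) \<otimes> a\<^sub>(\<^sub>2\<^sub>) \<otimes> a\<^sub>(\<^sub>3\<^sub>)\<close>.\<close>
definition comult3 :: "'a \<Rightarrow> ('k, 'a) tensor3" where
  "comult3 a = sweedler2 (\<Delta> a) (\<lambda>x y. sweedler2 (\<Delta> x) (\<lambda>u v. tens3 u v y))"

definition left_monoidal :: bool where
  "left_monoidal \<longleftrightarrow>
     (\<forall>a b c. \<epsilon> (a * b * c) = sweedler2 (\<Delta> b) (\<lambda>b1 b2. \<epsilon> (a * b1) * \<epsilon> (b2 * c)))"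

definition right_monoidal :: bool where
  "right_monoidal \<longleftrightarrow>
     (\<forall>a b c. \<epsilon> (a * b * c) = sweedler2 (\<Delta> b) (\<lambda>b1 b2. \<epsilon> (a * b2) * \<epsilon> (b1 * c)))"

definition comult_one_tens :: "('k, 'a) tensor3" where
  "comult_one_tens = sweedler2 (\<Delta> 1) (\<lambda>x y. tens3 x y 1)"  \<comment> \<open>\<open>\<Delta>(1) \<otimes> 1\<close>\<close>

definition tens_comult_one :: "('k, 'a) tensor3" where
  "tens_comult_one = sweedler2 (\<Delta> 1) (\<lambda>x y. tens3 1 x y)"  \<comment> \<open>\<open>1 \<otimes> \<Delta>(1)\<close>\<close>

definition left_comonoidal :: bool where
  "left_comonoidal \<longleftrightarrow> mult3 comult_one_tens tens_comult_one = comult3 1"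

definition right_comonoidal :: bool where
  "right_comonoidal \<longleftrightarrow> mult3 tens_comult_one comult_one_tens = comult3 1"

definition bimonoidal :: bool where
  "bimonoidal \<longleftrightarrow> left_monoidal \<and> right_monoidal \<and> left_comonoidal \<and> right_comonoidal"

definition pre_antipode :: "('a \<Rightarrow> 'a) \<Rightarrow> bool" where
  "pre_antipode S \<longleftrightarrow>
     Vector_Spaces.linear scale scale S \<and>
     (\<forall>a. sweedler2 (\<Delta> a) (\<lambda>a1 a2. a1 * S a2) = sweedler2 (\<Delta> 1) (\<lambda>x y. \<epsilon> (x * a) *s y)) \<and>
     (\<forall>a. sweedler2 (\<Delta> a) (\<lambda>a1 a2. S a1 * a2) = sweedler2 (\<Delta> 1) (\<lambda>x y. \<epsilon> (a * y) *s x))"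

definition antipode :: "('a \<Rightarrow> 'a) \<Rightarrow> bool" where
  "antipode S \<longleftrightarrow>
     pre_antipode S \<and> (\<forall>a. sweedler3 (comult3 a) (\<lambda>a1 a2 a3. S a1 * a2 * S a3) = S a)"

definition weak_hopf_algebra :: bool where
  "weak_hopf_algebra \<longleftrightarrow> bimonoidal \<and> (\<exists>S. antipode S)"

definition bialgebra_anti_morphism :: "('a \<Rightarrow> 'a) \<Rightarrow> bool" where
  "bialgebra_anti_morphism S \<longleftrightarrow>
     (\<forall>a b. S (a * b) = S b * S a) \<and>
     (\<forall>a. \<Delta> (S a) = sweedler2 (\<Delta> a) (\<lambda>a1 a2. tens2 (S a2) (S a1)))"

definition A_L :: "'a set" where
  "A_L = {sweedler2 (\<Delta> 1) (\<lambda>x y. \<phi> x *s y) | \<phi>. linear_form \<phi>}"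

definition A_R :: "'a set" where
  "A_R = {sweedler2 (\<Delta> 1) (\<lambda>x y. \<phi> y *s x) | \<phi>. linear_form \<phi>}"

text \<open>The product of the dual algebra \<open>Hom(A, K)\<close>.\<close>
definition dual_mult :: "('a \<Rightarrow> 'k) \<Rightarrow> ('a \<Rightarrow> 'k) \<Rightarrow> 'a \<Rightarrow> 'k" where
  "dual_mult \<phi> \<psi> = (\<lambda>a. sweedler2 (\<Delta> a) (\<lambda>x y. \<phi> x * \<psi> y))"

definition dual_L :: "('a \<Rightarrow> 'k) set" where
  "dual_L = {\<lambda>b. \<epsilon> (a * b) | a. True}"

definition dual_R :: "('a \<Rightarrow> 'k) set" where
  "dual_R = {\<lambda>b. \<epsilon> (b * a) | a. True}"

end

definition commuting :: "('b \<Rightarrow> 'b \<Rightarrow> 'b) \<Rightarrow> 'b set \<Rightarrow> 'b set \<Rightarrow> bool" where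
  "commuting m X Y \<longleftrightarrow> (\<forall>x\<in>X. \<forall>y\<in>Y. m x y = m y x)"

end

theory Submission
  imports Defs
begin

text \<open>
  Write \<open>E\<^sub>L(a) = \<epsilon>(1\<^sub>1 a) 1\<^sub>2 = a\<^sub>1 S(a\<^sub>2)\<close> and \<open>E\<^sub>R(a) = 1\<^sub>1 \<epsilon>(a 1\<^sub>2) = S(a\<^sub>1) a\<^sub>2\<close>.  For an
  anti-morphism \<open>S\<close> one gets \<open>E\<^sub>L(ab) = a\<^sub>1 E\<^sub>L(b) S(a\<^sub>2)\<close> and
  \<open>\<Delta>(E\<^sub>L(a)) = a\<^sub>1 S(a\<^sub>3) \<otimes> E\<^sub>L(a\<^sub>2)\<close>, with mirror images for \<open>E\<^sub>R\<close>.  Every condition of the theorem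
  is equivalent to right comonoidality, which in turn amounts to the identity
  \<open>a\<^sub>1 \<otimes> E\<^sub>L(a\<^sub>2) = 1\<^sub>1 a \<otimes> 1\<^sub>2\<close> (*).  This identity makes \<open>S\<close> an antipode and \<open>E\<^sub>L\<close> idempotent, and
  right monoidality follows.

  If \<open>A\<^sub>L\<close> and \<open>A\<^sub>R\<close> commute, then
  \<open>x\<^sub>1 \<epsilon>(y x\<^sub>2) = x\<^sub>1 S(x\<^sub>2) E\<^sub>R(y) x\<^sub>3 = E\<^sub>R(y) x\<close>, which gives (*).  If the dual subalgebras commute,
  then (*) follows from \<open>1\<^sub>1 a \<otimes> 1\<^sub>2 = a\<^sub>1 S(a\<^sub>3) a\<^sub>4 \<otimes> E\<^sub>L(a\<^sub>2) = a\<^sub>1 E\<^sub>R(a\<^sub>3) \<otimes> E\<^sub>L(a\<^sub>2)\<close>, where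
  \<open>E\<^sub>R\<close> and \<open>E\<^sub>L\<close> may be interchanged.

  Conversely, let \<open>A\<close> be right comonoidal and \<open>l \<in> A\<^sub>L\<close>.  Then \<open>\<Delta>(l) = 1\<^sub>1 l \<otimes> 1\<^sub>2\<close> and
  \<open>1\<^sub>1 \<otimes> l 1\<^sub>2 = S(l) 1\<^sub>1 \<otimes> 1\<^sub>2\<close>, so with a second copy \<open>1'\<close> of \<open>1\<close>
  \<open>\<Delta>(l) = \<Delta>(l) \<Delta>(1) = 1\<^sub>1 l 1'\<^sub>1 \<otimes> 1\<^sub>2 1'\<^sub>2 = 1\<^sub>1 l S(1\<^sub>2) 1'\<^sub>1 \<otimes> 1'\<^sub>2 = E\<^sub>L(l) 1'\<^sub>1 \<otimes> 1'\<^sub>2 = l 1'\<^sub>1 \<otimes> 1'\<^sub>2\<close>,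
  that is, \<open>l\<close> commutes with \<open>A\<^sub>R\<close>.  Left comonoidality is then immediate.  Left monoidality holds because
  every \<open>c\<close> can be replaced in \<open>\<epsilon>(x c)\<close> by some \<open>r \<in> A\<^sub>R\<close> with \<open>S(r) = E\<^sub>L(c)\<close>, and
  \<open>\<Delta>(b r) = b\<^sub>1 \<otimes> b\<^sub>2 r\<close>.
\<close>

subsection \<open>Multilinear maps and tensors\<close>

context fd_algebra
begin

abbreviation lin :: "('k \<Rightarrow> 'b::ab_group_add \<Rightarrow> 'b) \<Rightarrow> ('a \<Rightarrow> 'b) \<Rightarrow> bool" where
  "lin s f \<equiv> Vector_Spaces.linear scale s f"

lemma lin_ident: "lin scale (\<lambda>x. x)"
  by (simp add: Vector_Spaces.linear_iff vector_space_axioms)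

lemma lin_mult_left: "lin scale f \<Longrightarrow> lin scale (\<lambda>x. f x * c)"
  by (simp add: Vector_Spaces.linear_iff scale_mult_left distrib_right)

lemma lin_mult_right: "lin scale f \<Longrightarrow> lin scale (\<lambda>x. c * f x)"
  by (simp add: Vector_Spaces.linear_iff scale_mult_right distrib_left)

lemma lin_scale_left: "vector_space s \<Longrightarrow> lin (*) f \<Longrightarrow> lin s (\<lambda>x. s (f x) c)"
  by (simp add: Vector_Spaces.linear_iff vector_space.vector_space_assms)

lemma lin_scale_right: "lin s f \<Longrightarrow> lin s (\<lambda>x. s c (f x))"
  by (simp add: Vector_Spaces.linear_iff vector_space.vector_space_assms mult.commute)

lemma lin_compose: "Vector_Spaces.linear s t g \<Longrightarrow> lin s f \<Longrightarrow> lin t (\<lambda>x. g (f x))"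
  by (simp add: Vector_Spaces.linear_iff)

lemma bilinear_mapI:
  "(\<And>y. lin s (\<lambda>x. F x y)) \<Longrightarrow> (\<And>x. lin s (\<lambda>y. F x y)) \<Longrightarrow> bilinear_map s F"
  by (simp add: bilinear_map_def)

lemma trilinear_mapI:
  "(\<And>y z. lin s (\<lambda>x. F x y z)) \<Longrightarrow> (\<And>x z. lin s (\<lambda>y. F x y z)) \<Longrightarrow>
    (\<And>x y. lin s (\<lambda>z. F x y z)) \<Longrightarrow> trilinear_map s F"
  by (simp add: trilinear_map_def)

text \<open>Slots are filled with a linear \<open>f\<close> rather than a variable, so that as
  introduction rules these decompose nested terms.\<close>

lemma
  assumes "bilinear_map s F"
  shows bilinear_lin1: "lin scale f \<Longrightarrow> lin s (\<lambda>x. F (f x) y)"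
    and bilinear_lin2: "lin scale f \<Longrightarrow> lin s (\<lambda>x. F y (f x))"
    and bilinear_vector_space: "vector_space s"
    and bilinear_scale1: "F (c *s x) y = s c (F x y)"
    and bilinear_scale2: "F x (c *s y) = s c (F x y)"
  using assms by (simp_all add: Vector_Spaces.linear_iff bilinear_map_def)

lemma
  assumes "trilinear_map s F"
  shows trilinear_lin1: "lin scale f \<Longrightarrow> lin s (\<lambda>x. F (f x) y z)"
    and trilinear_lin2: "lin scale f \<Longrightarrow> lin s (\<lambda>x. F y (f x) z)"
    and trilinear_lin3: "lin scale f \<Longrightarrow> lin s (\<lambda>x. F y z (f x))"
    and trilinear_vector_space: "vector_space s"
  using assms by (simp_all add: Vector_Spaces.linear_iff trilinear_map_def)

lemmas bilinear_lin = bilinear_lin1 bilinear_lin2 bilinear_vector_space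
lemmas trilinear_lin = trilinear_lin1 trilinear_lin2 trilinear_lin3 trilinear_vector_space

definition tensor_space3 :: "('k, 'a) tensor3 set" where
  "tensor_space3 = {\<Sum>(x, y, z)\<leftarrow>xs. tens3 x y z | xs. True}"

lemma sum_list_tensor_space2:
  "(\<And>p. h p \<in> tensor_space2) \<Longrightarrow> (\<Sum>p\<leftarrow>ps. h p) \<in> tensor_space2"
proof (induction ps)
  case Nil
  have "(\<Sum>(x, y)\<leftarrow>[]. tens2 x y) \<in> tensor_space2" unfolding tensor_space2_def by blast
  then show ?case by (simp only: list.map)
next
  case (Cons p ps)
  then obtain xs ys where "h p = (\<Sum>(x, y)\<leftarrow>xs. tens2 x y)"
    "(\<Sum>p\<leftarrow>ps. h p) = (\<Sum>(x, y)\<leftarrow>ys. tens2 x y)"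
    unfolding tensor_space2_def by blast
  then have "(\<Sum>p\<leftarrow>p # ps. h p) = (\<Sum>(x, y)\<leftarrow>xs @ ys. tens2 x y)" by simp
  then show ?case unfolding tensor_space2_def by blast
qed

lemma sum_list_tensor_space3:
  "(\<And>p. h p \<in> tensor_space3) \<Longrightarrow> (\<Sum>p\<leftarrow>ps. h p) \<in> tensor_space3"
proof (induction ps)
  case Nil
  have "(\<Sum>(x, y, z)\<leftarrow>[]. tens3 x y z) \<in> tensor_space3" unfolding tensor_space3_def by blast
  then show ?case by (simp only: list.map)
next
  case (Cons p ps)
  then obtain xs ys where "h p = (\<Sum>(x, y, z)\<leftarrow>xs. tens3 x y z)"
    "(\<Sum>p\<leftarrow>ps. h p) = (\<Sum>(x, y, z)\<leftarrow>ys. tens3 x y z)"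
    unfolding tensor_space3_def by blast
  then have "(\<Sum>p\<leftarrow>p # ps. h p) = (\<Sum>(x, y, z)\<leftarrow>xs @ ys. tens3 x y z)" by simp
  then show ?case unfolding tensor_space3_def by blast
qed

lemma sweedler2_tens2: "bilinear_map s F \<Longrightarrow> sweedler2 (tens2 x y) F = F x y"
  using sweedler2_sum[of s F "[(x, y)]"] by simp

lemma sweedler3_tens3: "trilinear_map s F \<Longrightarrow> sweedler3 (tens3 x y z) F = F x y z"
  using sweedler3_sum[of s F "[(x, y, z)]"] by simp

lemma tens2_in: "tens2 x y \<in> tensor_space2"
  unfolding tensor_space2_def by (auto intro!: exI[of _ "[(x, y)]"])

lemma tens3_in: "tens3 x y z \<in> tensor_space3"
  unfolding tensor_space3_def by (auto intro!: exI[of _ "[(x, y, z)]"])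

text \<open>Concatenated lists represent sums, and \<open>sweedler2\<close> may be computed from any
  representation; membership in \<open>tensor_space2\<close> guarantees that one exists.\<close>

lemma sweedler2_sum_list:
  assumes F: "bilinear_map s F" and h: "\<And>p. h p \<in> tensor_space2"
  shows "sweedler2 (\<Sum>p\<leftarrow>ps. h p) F = (\<Sum>p\<leftarrow>ps. sweedler2 (h p) F)"
proof (induction ps)
  case Nil
  show ?case using sweedler2_sum[OF F, of "[]"] by (simp only: list.map sum_list.Nil)
next
  case (Cons p ps)
  obtain xs ys where eq: "h p = (\<Sum>(x, y)\<leftarrow>xs. tens2 x y)"
    "(\<Sum>p\<leftarrow>ps. h p) = (\<Sum>(x, y)\<leftarrow>ys. tens2 x y)"
    using h sum_list_tensor_space2[of h ps, OF h] unfolding tensor_space2_def by blast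
  have "sweedler2 (\<Sum>p\<leftarrow>p # ps. h p) F = sweedler2 (\<Sum>(x, y)\<leftarrow>xs @ ys. tens2 x y) F"
    by (simp add: eq)
  also have "\<dots> = sweedler2 (h p) F + sweedler2 (\<Sum>p\<leftarrow>ps. h p) F"
    unfolding sweedler2_sum[OF F] eq by simp
  finally show ?case by (simp only: Cons list.map sum_list.Cons)
qed

lemma sweedler3_sum_list:
  assumes F: "trilinear_map s F" and h: "\<And>p. h p \<in> tensor_space3"
  shows "sweedler3 (\<Sum>p\<leftarrow>ps. h p) F = (\<Sum>p\<leftarrow>ps. sweedler3 (h p) F)"
proof (induction ps)
  case Nil
  show ?case using sweedler3_sum[OF F, of "[]"] by (simp only: list.map sum_list.Nil)
next
  case (Cons p ps)
  obtain xs ys where eq: "h p = (\<Sum>(x, y, z)\<leftarrow>xs. tens3 x y z)"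
    "(\<Sum>p\<leftarrow>ps. h p) = (\<Sum>(x, y, z)\<leftarrow>ys. tens3 x y z)"
    using h sum_list_tensor_space3[of h ps, OF h] unfolding tensor_space3_def by blast
  have "sweedler3 (\<Sum>p\<leftarrow>p # ps. h p) F = sweedler3 (\<Sum>(x, y, z)\<leftarrow>xs @ ys. tens3 x y z) F"
    by (simp add: eq)
  also have "\<dots> = sweedler3 (h p) F + sweedler3 (\<Sum>p\<leftarrow>ps. h p) F"
    unfolding sweedler3_sum[OF F] eq by simp
  finally show ?case by (simp only: Cons list.map sum_list.Cons)
qed

end

subsection \<open>Sweedler calculus\<close>

context weak_bialgebra
begin

text \<open>
  \<open>sw a f\<close> is \<open>f(a\<^sub>1, a\<^sub>2)\<close>, summed over one chosen representation of \<open>\<Delta> a\<close>.  Unlike \<open>sweedler2\<close> it is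
  additive in \<open>f\<close> and admits interchange of sums for arbitrary \<open>f\<close>; multilinearity is only needed
  where a property of \<open>\<Delta>\<close> enters.
\<close>

definition cop :: "'a \<Rightarrow> ('a \<times> 'a) list" where
  "cop a = (SOME xs. \<Delta> a = (\<Sum>(x, y)\<leftarrow>xs. tens2 x y))"

definition sw :: "'a \<Rightarrow> ('a \<Rightarrow> 'a \<Rightarrow> 'b::ab_group_add) \<Rightarrow> 'b" where
  "sw a f = (\<Sum>(x, y)\<leftarrow>cop a. f x y)"

lemma comult_eq_cop: "\<Delta> a = (\<Sum>(x, y)\<leftarrow>cop a. tens2 x y)"
  unfolding cop_def by (rule someI_ex) (use comult_in[of a] in \<open>auto simp: tensor_space2_def\<close>)

lemma comult_eq_sw: "\<Delta> a = sw a tens2"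
  unfolding sw_def by (rule comult_eq_cop)

lemma sweedler2_comult: "bilinear_map s F \<Longrightarrow> sweedler2 (\<Delta> a) F = sw a F"
  unfolding sw_def by (subst comult_eq_cop) (rule sweedler2_sum)

lemma sw_cong: "(\<And>x y. f x y = g x y) \<Longrightarrow> sw a f = sw a g"
  by (simp add: sw_def)

lemma sw_add: "sw a (\<lambda>x y. f x y + g x y) = sw a f + sw a g"
  unfolding sw_def by (simp add: case_prod_unfold sum_list_addf)

lemma sw_linear: "Vector_Spaces.linear s t g \<Longrightarrow> g (sw a f) = sw a (\<lambda>x y. g (f x y))"
  unfolding sw_def by (simp add: linear_sum_list case_prod_unfold)

lemma sw_swap: "sw a (\<lambda>x y. sw b (\<lambda>u v. f x y u v)) = sw b (\<lambda>u v. sw a (\<lambda>x y. f x y u v))"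
proof -
  have "(\<Sum>p\<leftarrow>ps. \<Sum>q\<leftarrow>qs. g p q) = (\<Sum>q\<leftarrow>qs. \<Sum>p\<leftarrow>ps. g p q)"
    for ps qs and g :: "'a \<times> 'a \<Rightarrow> 'a \<times> 'a \<Rightarrow> 'b"
    by (induction ps) (simp_all add: sum_list_addf)
  then show ?thesis by (simp add: sw_def case_prod_unfold)
qed

lemma sw_scale: "vector_space s \<Longrightarrow> s c (sw a f) = sw a (\<lambda>x y. s c (f x y))"
  by (rule sw_linear[of s s]) (simp add: Vector_Spaces.linear_iff vector_space.vector_space_assms mult.commute)

lemma sw_mult_left: "sw a f * (c :: 'a) = sw a (\<lambda>x y. f x y * c)"
  by (rule sw_linear[OF lin_mult_left[OF lin_ident]])

lemma sw_mult_right: "(c :: 'a) * sw a f = sw a (\<lambda>x y. c * f x y)"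
  by (rule sw_linear[OF lin_mult_right[OF lin_ident]])

lemma
  assumes "bilinear_map s F"
  shows bilinear_sw1: "F (sw a f) y = sw a (\<lambda>u v. F (f u v) y)"
    and bilinear_sw2: "F y (sw a f) = sw a (\<lambda>u v. F y (f u v))"
  by (rule sw_linear bilinear_lin[OF assms] lin_ident)+

text \<open>The lists \<open>cop (x + y)\<close> and \<open>cop x @ cop y\<close> are unrelated but
  represent the same tensor, so a bilinear \<open>F\<close> has the same sum over both.\<close>

lemma lin_sw_arg:
  assumes "lin scale f" and F: "bilinear_map s F"
  shows "lin s (\<lambda>x. sw (f x) F)"
proof -
  interpret s: vector_space s using F by (rule bilinear_vector_space)
  have \<Delta>: "\<Delta> (x + y) = \<Delta> x + \<Delta> y" "\<Delta> (c *s x) = tensor_scale c (\<Delta> x)" for c x y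
    using comult_linear by (simp_all add: Vector_Spaces.linear_iff)
  have "sw (x + y) F = sw x F + sw y F" for x y
  proof -
    have "sw (x + y) F = sweedler2 (\<Sum>(x, y)\<leftarrow>cop x @ cop y. tens2 x y) F"
      by (simp add: sweedler2_comult[OF F, symmetric] \<Delta> comult_eq_cop[symmetric])
    then show ?thesis unfolding sweedler2_sum[OF F] sw_def by simp
  qed
  moreover have "sw (c *s x) F = s c (sw x F)" for c x
  proof -
    \<comment> \<open>Scaling the first legs in \<open>cop x\<close> represents the scaled
      tensor.\<close>
    have "tensor_scale c (\<Delta> x) = (\<Sum>(x, y)\<leftarrow>map (\<lambda>(x, y). (c *s x, y)) (cop x). tens2 x y)"
      using bilinear_scale1[OF bilinear_map_tens2] sw_scale[OF vector_space_tensor_scale, of c x tens2]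
      by (simp add: comult_eq_sw) (simp add: sw_def case_prod_unfold comp_def)
    then have "sw (c *s x) F =
        sweedler2 (\<Sum>(x, y)\<leftarrow>map (\<lambda>(x, y). (c *s x, y)) (cop x). tens2 x y) F"
      by (simp only: sweedler2_comult[OF F, symmetric] \<Delta>)
    also have "\<dots> = sw x (\<lambda>x y. s c (F x y))"
      unfolding sweedler2_sum[OF F] sw_def
      by (simp add: case_prod_unfold comp_def bilinear_scale1[OF F])
    finally show ?thesis by (simp add: sw_scale[OF s.vector_space_axioms])
  qed
  ultimately have "lin s (\<lambda>x. sw x F)"
    by (simp add: Vector_Spaces.linear_iff s.vector_space_axioms vector_space_axioms)
  then show ?thesis using assms(1) by (rule lin_compose)
qed

lemma lin_sw_body:
  assumes "vector_space s" and "\<And>u v. lin s (\<lambda>x. G x u v)"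
  shows "lin s (\<lambda>x. sw a (\<lambda>u v. G x u v))"
proof -
  have "sw a (G (x + y)) = sw a (\<lambda>u v. G x u v + G y u v)" for x y
    by (rule sw_cong) (use assms(2) in \<open>simp add: Vector_Spaces.linear_iff\<close>)
  moreover have "sw a (G (c *s x)) = sw a (\<lambda>u v. s c (G x u v))" for c x
    by (rule sw_cong) (use assms(2) in \<open>simp add: Vector_Spaces.linear_iff\<close>)
  ultimately show ?thesis
    by (simp add: Vector_Spaces.linear_iff sw_add sw_scale assms(1) vector_space_axioms)
qed

lemma lin_counit: "lin scale f \<Longrightarrow> lin (*) (\<lambda>x. \<epsilon> (f x))"
  using counit_linear unfolding linear_form_def by (rule lin_compose)

text \<open>Structural rules for the multilinearity side conditions; rules for \<open>S\<close>,
  \<open>EL\<close>, \<open>ER\<close> and a given \<open>F\<close> are added locally.\<close>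

lemmas lin_intros = bilinear_mapI trilinear_mapI lin_ident lin_mult_left lin_mult_right
  lin_scale_left lin_scale_right lin_counit lin_sw_arg lin_sw_body
  vector_space_axioms vector_space_field vector_space_tensor_scale

lemma counit_sw: "\<epsilon> (sw a f) = sw a (\<lambda>x y. \<epsilon> (f x y))"
  by (rule sw_linear[OF lin_counit[OF lin_ident]])

lemma counit_scale: "\<epsilon> (c *s x) = c * \<epsilon> x"
  using counit_linear by (simp add: linear_form_def Vector_Spaces.linear_iff)

lemma sw_tensor_space2: "(\<And>x y. h x y \<in> tensor_space2) \<Longrightarrow> sw a h \<in> tensor_space2"
  unfolding sw_def by (rule sum_list_tensor_space2) auto

lemma sw_tensor_space3: "(\<And>x y. h x y \<in> tensor_space3) \<Longrightarrow> sw a h \<in> tensor_space3"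
  unfolding sw_def by (rule sum_list_tensor_space3) auto

lemma sweedler2_sw:
  "bilinear_map s F \<Longrightarrow> (\<And>x y. h x y \<in> tensor_space2) \<Longrightarrow>
    sweedler2 (sw a h) F = sw a (\<lambda>x y. sweedler2 (h x y) F)"
  unfolding sw_def by (subst sweedler2_sum_list) (auto simp: case_prod_unfold)

lemma sweedler3_sw:
  "trilinear_map s F \<Longrightarrow> (\<And>x y. h x y \<in> tensor_space3) \<Longrightarrow>
    sweedler3 (sw a h) F = sw a (\<lambda>x y. sweedler3 (h x y) F)"
  unfolding sw_def by (subst sweedler3_sum_list) (auto simp: case_prod_unfold)

lemma sw_mult:
  assumes F: "bilinear_map s F"
  shows "sw (a * b) F = sw a (\<lambda>x y. sw b (\<lambda>u v. F (x * u) (y * v)))"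
proof -
  note L = bilinear_lin[OF bilinear_map_tens2] bilinear_lin[OF F]
  have "sw (a * b) F = sweedler2 (mult2 (\<Delta> a) (\<Delta> b)) F"
    by (simp only: sweedler2_comult[OF F, symmetric] comult_mult)
  also have "mult2 (\<Delta> a) (\<Delta> b) =
      sw a (\<lambda>x y. sweedler2 (\<Delta> b) (\<lambda>u v. tens2 (x * u) (y * v)))"
    unfolding mult2_def
    by (subst sweedler2_comult[of tensor_scale])+ (intro lin_intros L refl)+
  also have "\<dots> = sw a (\<lambda>x y. sw b (\<lambda>u v. tens2 (x * u) (y * v)))"
    by (rule sw_cong, rule sweedler2_comult[of tensor_scale]) (intro lin_intros L)
  finally show ?thesis
    by (simp add: sweedler2_sw[OF F] sweedler2_tens2[OF F] sw_tensor_space2 tens2_in)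
qed

text \<open>The axiom equates two tensors; applying the linear map induced by \<open>F\<close> to
  both transfers it to every trilinear \<open>F\<close>.\<close>

lemma sw_coassoc:
  assumes F: "trilinear_map s F"
  shows "sw a (\<lambda>x y. sw x (\<lambda>u v. F u v y)) = sw a (\<lambda>x y. sw y (\<lambda>u v. F x u v))"
proof -
  note L = trilinear_lin[OF trilinear_map_tens3]
  have "sweedler2 (\<Delta> a) (\<lambda>x y. sweedler2 (\<Delta> x) (\<lambda>u v. tens3 u v y)) =
      sw a (\<lambda>x y. sw x (\<lambda>u v. tens3 u v y))"
    by (subst sweedler2_comult[of tensor_scale], (intro lin_intros L refl)+)+
  moreover have "sweedler2 (\<Delta> a) (\<lambda>x y. sweedler2 (\<Delta> y) (\<lambda>u v. tens3 x u v)) =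
      sw a (\<lambda>x y. sw y (\<lambda>u v. tens3 x u v))"
    by (subst sweedler2_comult[of tensor_scale], (intro lin_intros L refl)+)+
  ultimately have "sw a (\<lambda>x y. sw x (\<lambda>u v. tens3 u v y)) = sw a (\<lambda>x y. sw y (\<lambda>u v. tens3 x u v))"
    using coassoc[of a] by simp
  then have "sweedler3 (sw a (\<lambda>x y. sw x (\<lambda>u v. tens3 u v y))) F =
      sweedler3 (sw a (\<lambda>x y. sw y (\<lambda>u v. tens3 x u v))) F" by simp
  then show ?thesis
    by (simp add: sweedler3_sw[OF F] sweedler3_tens3[OF F] sw_tensor_space3 tens3_in)
qed

lemma comult3_eq_sw: "comult3 a = sw a (\<lambda>x y. sw x (\<lambda>u v. tens3 u v y))"
  unfolding comult3_def
  by (subst sweedler2_comult[of tensor_scale],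
      (intro lin_intros trilinear_lin[OF trilinear_map_tens3] refl)+)+

lemma sw_counit_left: "lin s f \<Longrightarrow> sw a (\<lambda>x y. s (\<epsilon> x) (f y)) = f a"
proof -
  assume f: "lin s f"
  have "f a = f (sw a (\<lambda>x y. \<epsilon> x *s y))"
    using counit_left[of a] by (subst (asm) sweedler2_comult[of scale]) (intro lin_intros, simp)
  also have "\<dots> = sw a (\<lambda>x y. s (\<epsilon> x) (f y))"
    by (subst sw_linear[OF f]) (use f in \<open>simp add: Vector_Spaces.linear_iff\<close>)
  finally show ?thesis by simp
qed

lemma sw_counit_right: "lin s f \<Longrightarrow> sw a (\<lambda>x y. s (\<epsilon> y) (f x)) = f a"
proof -
  assume f: "lin s f"
  have "f a = f (sw a (\<lambda>x y. \<epsilon> y *s x))"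
    using counit_right[of a] by (subst (asm) sweedler2_comult[of scale]) (intro lin_intros, simp)
  also have "\<dots> = sw a (\<lambda>x y. s (\<epsilon> y) (f x))"
    by (subst sw_linear[OF f]) (use f in \<open>simp add: Vector_Spaces.linear_iff\<close>)
  finally show ?thesis by simp
qed

section \<open>The counital maps\<close>

definition EL :: "'a \<Rightarrow> 'a" where
  "EL a = sw 1 (\<lambda>x y. \<epsilon> (x * a) *s y)"

definition ER :: "'a \<Rightarrow> 'a" where
  "ER a = sw 1 (\<lambda>x y. \<epsilon> (a * y) *s x)"

lemma lin_EL: "lin scale f \<Longrightarrow> lin scale (\<lambda>x. EL (f x))"
  unfolding EL_def by (intro lin_intros)

lemma lin_ER: "lin scale f \<Longrightarrow> lin scale (\<lambda>x. ER (f x))"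
  unfolding ER_def by (intro lin_intros)

lemma EL_one: "EL 1 = 1"
  using sw_counit_left[OF lin_ident, of 1] by (simp add: EL_def)

lemma ER_one: "ER 1 = 1"
  using sw_counit_right[OF lin_ident, of 1] by (simp add: ER_def)

lemma counit_EL: "\<epsilon> (EL a) = \<epsilon> a"
proof -
  have "\<epsilon> (EL a) = sw 1 (\<lambda>x y. \<epsilon> y * \<epsilon> (x * a))"
    by (simp add: EL_def counit_sw counit_scale mult.commute)
  also have "\<dots> = \<epsilon> (1 * a)"
    by (rule sw_counit_right) (intro lin_intros)
  finally show ?thesis by simp
qed

text \<open>\<open>\<Delta> 1\<close> need not be \<open>tens2 1 1\<close>, but by multiplicativity
  it can be inserted before \<open>\<Delta> a\<close> or absorbed into it.\<close>

lemma sw_one_mult: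
  assumes "bilinear_map s F"
  shows "sw 1 (\<lambda>u v. sw a (\<lambda>x y. F (u * x) (v * y))) = sw a F"
  using sw_mult[OF assms, of 1 a] by simp

lemma sw_mult_one:
  assumes "bilinear_map s F"
  shows "sw 1 (\<lambda>u v. sw a (\<lambda>x y. F (x * u) (y * v))) = sw a F"
  using sw_mult[OF assms, of a 1] by (simp add: sw_swap[of a 1])

text \<open>In \<open>\<epsilon>(1\<^sub>1 a\<^sub>1) 1\<^sub>2 a\<^sub>2\<close> the factor
  \<open>\<Delta> 1\<close> is absorbed, and the counit axiom remains.\<close>

lemma EL_mult_sw: "sw a (\<lambda>x y. EL x * y) = a"
proof -
  have "sw a (\<lambda>x y. EL x * y) = sw 1 (\<lambda>u v. sw a (\<lambda>x y. \<epsilon> (u * x) *s (v * y)))"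
    by (subst sw_swap, rule sw_cong) (simp add: EL_def sw_mult_left scale_mult_left)
  also have "\<dots> = sw a (\<lambda>x y. \<epsilon> x *s y)"
    by (rule sw_one_mult[of scale]) (intro lin_intros)
  also have "\<dots> = a"
    by (rule sw_counit_left) (intro lin_intros)
  finally show ?thesis .
qed

lemma mult_ER_sw: "sw a (\<lambda>x y. x * ER y) = a"
proof -
  have "sw a (\<lambda>x y. x * ER y) = sw 1 (\<lambda>u v. sw a (\<lambda>x y. \<epsilon> (y * v) *s (x * u)))"
    by (subst sw_swap, rule sw_cong) (simp add: ER_def sw_mult_right scale_mult_right)
  also have "\<dots> = sw a (\<lambda>x y. \<epsilon> y *s x)"
    by (rule sw_mult_one[of scale "\<lambda>x y. \<epsilon> y *s x"]) (intro lin_intros)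
  also have "\<dots> = a"
    by (rule sw_counit_right) (intro lin_intros)
  finally show ?thesis .
qed

subsection \<open>Right comonoidality\<close>

lemma mult3_sw_tens3:
  "mult3 (sw a (\<lambda>x y. tens3 (f1 x y) (f2 x y) (f3 x y))) (sw b (\<lambda>x y. tens3 (g1 x y) (g2 x y) (g3 x y))) =
    sw a (\<lambda>x y. sw b (\<lambda>u v. tens3 (f1 x y * g1 u v) (f2 x y * g2 u v) (f3 x y * g3 u v)))"
proof -
  note L = trilinear_lin[OF trilinear_map_tens3]
  have inner: "sweedler3 (sw b (\<lambda>x y. tens3 (g1 x y) (g2 x y) (g3 x y)))
      (\<lambda>p q r. tens3 (x * p) (y * q) (z * r)) =
      sw b (\<lambda>u v. tens3 (x * g1 u v) (y * g2 u v) (z * g3 u v))" for x y z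
    by (subst sweedler3_sw[of tensor_scale], intro lin_intros L, rule tens3_in, rule sw_cong,
        rule sweedler3_tens3[of tensor_scale], intro lin_intros L)
  show ?thesis
    unfolding mult3_def inner
    by (subst sweedler3_sw[of tensor_scale], intro lin_intros L, rule tens3_in, rule sw_cong,
        rule sweedler3_tens3[of tensor_scale], intro lin_intros L)
qed

lemma comult_one_tens_sw: "comult_one_tens = sw 1 (\<lambda>x y. tens3 x y 1)"
  unfolding comult_one_tens_def
  by (rule sweedler2_comult[of tensor_scale]) (intro lin_intros trilinear_lin[OF trilinear_map_tens3])

lemma tens_comult_one_sw: "tens_comult_one = sw 1 (\<lambda>x y. tens3 1 x y)"
  unfolding tens_comult_one_def
  by (rule sweedler2_comult[of tensor_scale]) (intro lin_intros trilinear_lin[OF trilinear_map_tens3])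

lemma right_comonoidal_iff:
  "right_comonoidal \<longleftrightarrow>
    sw 1 (\<lambda>x y. sw 1 (\<lambda>u v. tens3 x (u * y) v)) = sw 1 (\<lambda>x y. sw x (\<lambda>u v. tens3 u v y))"
  unfolding right_comonoidal_def comult_one_tens_sw tens_comult_one_sw mult3_sw_tens3 comult3_eq_sw
  by (subst sw_swap) simp

lemma left_comonoidal_iff:
  "left_comonoidal \<longleftrightarrow>
    sw 1 (\<lambda>x y. sw 1 (\<lambda>u v. tens3 x (y * u) v)) = sw 1 (\<lambda>x y. sw x (\<lambda>u v. tens3 u v y))"
  unfolding left_comonoidal_def comult_one_tens_sw tens_comult_one_sw mult3_sw_tens3 comult3_eq_sw
  by simp

lemma right_comonoidalD:
  assumes rc: right_comonoidal and F: "trilinear_map s F"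
  shows "sw 1 (\<lambda>x y. sw 1 (\<lambda>u v. F x (u * y) v)) = sw 1 (\<lambda>x y. sw x (\<lambda>u v. F u v y))"
proof -
  from rc have "sweedler3 (sw 1 (\<lambda>x y. sw 1 (\<lambda>u v. tens3 x (u * y) v))) F =
      sweedler3 (sw 1 (\<lambda>x y. sw x (\<lambda>u v. tens3 u v y))) F"
    unfolding right_comonoidal_iff by simp
  then show ?thesis
    by (simp add: sweedler3_sw[OF F] sweedler3_tens3[OF F] sw_tensor_space3 tens3_in)
qed

lemma monoidal_iff:
  "left_monoidal \<longleftrightarrow> (\<forall>a b c. \<epsilon> (a * b * c) = sw b (\<lambda>x y. \<epsilon> (a * x) * \<epsilon> (y * c)))"
  "right_monoidal \<longleftrightarrow> (\<forall>a b c. \<epsilon> (a * b * c) = sw b (\<lambda>x y. \<epsilon> (a * y) * \<epsilon> (x * c)))"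
proof -
  have "sweedler2 (\<Delta> b) (\<lambda>x y. \<epsilon> (a * x) * \<epsilon> (y * c)) = sw b (\<lambda>x y. \<epsilon> (a * x) * \<epsilon> (y * c))"
    "sweedler2 (\<Delta> b) (\<lambda>x y. \<epsilon> (a * y) * \<epsilon> (x * c)) = sw b (\<lambda>x y. \<epsilon> (a * y) * \<epsilon> (x * c))"
    for a b c
    by (rule sweedler2_comult[of "(*)"], intro lin_intros)+
  then show
    "left_monoidal \<longleftrightarrow> (\<forall>a b c. \<epsilon> (a * b * c) = sw b (\<lambda>x y. \<epsilon> (a * x) * \<epsilon> (y * c)))"
    "right_monoidal \<longleftrightarrow> (\<forall>a b c. \<epsilon> (a * b * c) = sw b (\<lambda>x y. \<epsilon> (a * y) * \<epsilon> (x * c)))"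
    unfolding left_monoidal_def right_monoidal_def by simp_all
qed

text \<open>Evaluated at \<open>b\<close>, the product of the two functionals is the right side of
  left monoidality, and the opposite product that of right monoidality.\<close>

lemma commuting_dual_iff:
  "commuting dual_mult dual_L dual_R \<longleftrightarrow>
    (\<forall>a b c. sw b (\<lambda>x y. \<epsilon> (a * x) * \<epsilon> (y * c)) = sw b (\<lambda>x y. \<epsilon> (a * y) * \<epsilon> (x * c)))"
proof -
  have 1: "dual_mult (\<lambda>x. \<epsilon> (a * x)) (\<lambda>x. \<epsilon> (x * c)) = (\<lambda>b. sw b (\<lambda>x y. \<epsilon> (a * x) * \<epsilon> (y * c)))"
    for a c
    unfolding dual_mult_def by (rule ext, rule sweedler2_comult[of "(*)"], intro lin_intros)
  have 2: "dual_mult (\<lambda>x. \<epsilon> (x * c)) (\<lambda>x. \<epsilon> (a * x)) = (\<lambda>b. sw b (\<lambda>x y. \<epsilon> (a * y) * \<epsilon> (x * c)))"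
    for a c
    unfolding dual_mult_def
    by (rule ext, subst sweedler2_comult[of "(*)"], intro lin_intros, simp add: mult.commute)
  have "commuting dual_mult dual_L dual_R \<longleftrightarrow>
      (\<forall>a c. dual_mult (\<lambda>x. \<epsilon> (a * x)) (\<lambda>x. \<epsilon> (x * c)) =
        dual_mult (\<lambda>x. \<epsilon> (x * c)) (\<lambda>x. \<epsilon> (a * x)))"
    unfolding commuting_def dual_L_def dual_R_def by blast
  then show ?thesis unfolding 1 2 by (auto simp: fun_eq_iff)
qed

lemma sw_EL:
  assumes F: "bilinear_map s F"
  shows "sw (EL a) F = sw 1 (\<lambda>x y. s (\<epsilon> (x * a)) (sw y F))"
proof -
  have lin: "lin s (\<lambda>x. sw x F)" by (intro lin_intros F)
  then show ?thesis
    unfolding EL_def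
    by (subst sw_linear[OF lin]) (simp add: Vector_Spaces.linear_iff)
qed

lemma sw_ER:
  assumes F: "bilinear_map s F"
  shows "sw (ER a) F = sw 1 (\<lambda>x y. s (\<epsilon> (a * y)) (sw x F))"
proof -
  have lin: "lin s (\<lambda>x. sw x F)" by (intro lin_intros F)
  then show ?thesis
    unfolding ER_def
    by (subst sw_linear[OF lin]) (simp add: Vector_Spaces.linear_iff)
qed

section \<open>The shift identity, equivalent to right comonoidality\<close>

definition EL_shift :: bool where
  "EL_shift \<longleftrightarrow> (\<forall>a. sw a (\<lambda>x y. tens2 x (EL y)) = sw 1 (\<lambda>x y. tens2 (x * a) y))"

lemma EL_shiftD:
  assumes EL_shift and F: "bilinear_map s F"
  shows "sw a (\<lambda>x y. F x (EL y)) = sw 1 (\<lambda>x y. F (x * a) y)"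
proof -
  from assms(1) have "sweedler2 (sw a (\<lambda>x y. tens2 x (EL y))) F =
      sweedler2 (sw 1 (\<lambda>x y. tens2 (x * a) y)) F"
    unfolding EL_shift_def by simp
  then show ?thesis
    by (simp add: sweedler2_sw[OF F] sweedler2_tens2[OF F] tens2_in)
qed

text \<open>Writing \<open>a\<close> as \<open>1 a\<close> exposes \<open>1\<^sub>1 \<otimes>
  1'\<^sub>1 1\<^sub>2 \<otimes> 1'\<^sub>2\<close>; right comonoidality makes this an iterated
  coproduct, whose middle leg the counit removes.\<close>

lemma right_comonoidal_EL_shift:
  assumes rc: right_comonoidal
  shows EL_shift
proof -
  have "sw a (\<lambda>x y. F x (EL y)) = sw 1 (\<lambda>x y. F (x * a) y)"
    if F: "bilinear_map s F" for s :: "'k \<Rightarrow> 'b::ab_group_add \<Rightarrow> 'b" and F a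
  proof -
    note L = bilinear_lin[OF F] lin_intros lin_EL
    have "sw a (\<lambda>x y. F x (EL y)) = sw 1 (\<lambda>p q. sw a (\<lambda>x y. F (p * x) (EL (q * y))))"
      by (rule sw_one_mult[of s, symmetric]) (intro L)
    also have "\<dots> = sw 1 (\<lambda>p q. sw a (\<lambda>x y. sw 1 (\<lambda>u v. s (\<epsilon> (u * q * y)) (F (p * x) v))))"
      by (intro sw_cong) (simp add: EL_def bilinear_sw2[OF F] bilinear_scale2[OF F] mult.assoc)
    also have "\<dots> = sw a (\<lambda>x y. sw 1 (\<lambda>p q. sw 1 (\<lambda>u v. s (\<epsilon> (u * q * y)) (F (p * x) v))))"
      by (rule sw_swap)
    also have "\<dots> = sw a (\<lambda>x y. sw 1 (\<lambda>p q. sw p (\<lambda>u v. s (\<epsilon> (v * y)) (F (u * x) q))))"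
      by (rule sw_cong, rule right_comonoidalD[OF rc, of s]) (intro L)
    also have "\<dots> = sw 1 (\<lambda>p q. sw a (\<lambda>x y. sw p (\<lambda>u v. s (\<epsilon> (v * y)) (F (u * x) q))))"
      by (rule sw_swap)
    also have "\<dots> = sw 1 (\<lambda>p q. sw (p * a) (\<lambda>u v. s (\<epsilon> v) (F u q)))"
      by (rule sw_cong, subst sw_swap, rule sw_mult[of s, symmetric]) (intro L)
    also have "\<dots> = sw 1 (\<lambda>p q. F (p * a) q)"
      by (rule sw_cong, rule sw_counit_right[of s]) (intro L)
    finally show ?thesis .
  qed
  then show ?thesis
    unfolding EL_shift_def using bilinear_map_tens2 by blast
qed

text \<open>The mirror image, starting from \<open>a 1\<close>; coassociativity groups the middle
  leg with the last before the counit acts.\<close>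

lemma right_comonoidal_ER_shift:
  assumes rc: right_comonoidal and F: "bilinear_map s F"
  shows "sw a (\<lambda>x y. F (ER x) y) = sw 1 (\<lambda>x y. F x (a * y))"
proof -
  note L = bilinear_lin[OF F] lin_intros lin_ER
  have "sw a (\<lambda>x y. F (ER x) y) = sw 1 (\<lambda>p q. sw a (\<lambda>x y. F (ER (x * p)) (y * q)))"
    by (rule sw_mult_one[of s "\<lambda>x y. F (ER x) y", symmetric]) (intro L)
  also have "\<dots> = sw 1 (\<lambda>p q. sw a (\<lambda>x y. sw 1 (\<lambda>u v. s (\<epsilon> (x * (p * v))) (F u (y * q)))))"
    by (intro sw_cong) (simp add: ER_def bilinear_sw1[OF F] bilinear_scale1[OF F] mult.assoc)
  also have "\<dots> = sw a (\<lambda>x y. sw 1 (\<lambda>p q. sw 1 (\<lambda>u v. s (\<epsilon> (x * (p * v))) (F u (y * q)))))"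
    by (rule sw_swap)
  also have "\<dots> = sw a (\<lambda>x y. sw 1 (\<lambda>u v. sw 1 (\<lambda>p q. s (\<epsilon> (x * (p * v))) (F u (y * q)))))"
    by (rule sw_cong, rule sw_swap)
  also have "\<dots> = sw a (\<lambda>x y. sw 1 (\<lambda>p q. sw p (\<lambda>u v. s (\<epsilon> (x * v)) (F u (y * q)))))"
    by (rule sw_cong, rule right_comonoidalD[OF rc, of s]) (intro L)
  also have "\<dots> = sw a (\<lambda>x y. sw 1 (\<lambda>p q. sw q (\<lambda>u v. s (\<epsilon> (x * u)) (F p (y * v)))))"
    by (rule sw_cong, rule sw_coassoc[of s]) (intro L)
  also have "\<dots> = sw 1 (\<lambda>p q. sw a (\<lambda>x y. sw q (\<lambda>u v. s (\<epsilon> (x * u)) (F p (y * v)))))"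
    by (rule sw_swap)
  also have "\<dots> = sw 1 (\<lambda>p q. sw (a * q) (\<lambda>u v. s (\<epsilon> u) (F p v)))"
    by (rule sw_cong, rule sw_mult[of s, symmetric]) (intro L)
  also have "\<dots> = sw 1 (\<lambda>p q. F p (a * q))"
    by (rule sw_cong, rule sw_counit_left[of s]) (intro L)
  finally show ?thesis .
qed

text \<open>The shift identity at the second leg of \<open>\<Delta> 1\<close> produces
  \<open>1\<^sub>1 \<otimes> 1\<^sub>2 \<otimes> EL(1\<^sub>3)\<close>, and at \<open>1\<close> it
  removes the \<open>EL\<close>.\<close>

lemma EL_shift_right_comonoidal:
  assumes B: EL_shift
  shows right_comonoidal
proof -
  note L = lin_intros lin_EL trilinear_lin[OF trilinear_map_tens3]
  have "sw 1 (\<lambda>x y. sw 1 (\<lambda>u v. tens3 x (u * y) v)) =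
      sw 1 (\<lambda>x y. sw y (\<lambda>u v. tens3 x u (EL v)))"
    by (rule sw_cong, rule EL_shiftD[OF B, of tensor_scale, symmetric]) (intro L)
  also have "\<dots> = sw 1 (\<lambda>x y. sw x (\<lambda>u v. tens3 u v (EL y)))"
    by (rule sw_coassoc[of tensor_scale, symmetric]) (intro L)
  also have "\<dots> = sw 1 (\<lambda>x y. sw (x * 1) (\<lambda>u v. tens3 u v y))"
    by (rule EL_shiftD[OF B, of tensor_scale]) (intro L)
  finally show ?thesis by (simp add: right_comonoidal_iff)
qed

text \<open>At \<open>a = 1\<close> the shift identity says that \<open>EL\<close> acts on the
  second leg of \<open>\<Delta> 1\<close> without effect.\<close>

lemma EL_idem:
  assumes B: EL_shift
  shows "EL (EL a) = EL a"
proof -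
  have "EL (EL a) = sw 1 (\<lambda>x y. \<epsilon> (x * a) *s EL y)"
    unfolding EL_def[of a] by (subst sw_linear[OF lin_EL[OF lin_ident]])
      (use lin_EL[OF lin_ident] in \<open>simp add: Vector_Spaces.linear_iff\<close>)
  also have "\<dots> = sw 1 (\<lambda>x y. \<epsilon> (x * 1 * a) *s y)"
    by (rule EL_shiftD[OF B, of scale]) (intro lin_intros)
  finally show ?thesis by (simp add: EL_def)
qed

end

subsection \<open>Pre-antipodes that are anti-morphisms\<close>

locale antimorphic_preantipode = weak_bialgebra scale \<Delta> \<epsilon>
  for scale :: "'k::field \<Rightarrow> 'a::{ring, monoid_mult} \<Rightarrow> 'a" (infixr "*s" 75) and \<Delta> \<epsilon> +
  fixes S :: "'a \<Rightarrow> 'a"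
  assumes pre_antipode: "pre_antipode S"
    and anti_morphism: "bialgebra_anti_morphism S"
begin

lemma lin_S: "lin scale f \<Longrightarrow> lin scale (\<lambda>x. S (f x))"
  using pre_antipode unfolding pre_antipode_def by (blast intro: lin_compose)

lemma S_mult: "S (a * b) = S b * S a"
  using anti_morphism by (simp add: bialgebra_anti_morphism_def)

lemma mult_S_sw: "sw a (\<lambda>x y. x * S y) = EL a"
proof -
  have "sw a (\<lambda>x y. x * S y) = sweedler2 (\<Delta> a) (\<lambda>x y. x * S y)"
    by (rule sweedler2_comult[of scale, symmetric]) (intro lin_intros lin_S)
  also have "\<dots> = sweedler2 (\<Delta> 1) (\<lambda>x y. \<epsilon> (x * a) *s y)"
    using pre_antipode by (simp add: pre_antipode_def)
  also have "\<dots> = EL a"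
    unfolding EL_def by (rule sweedler2_comult[of scale]) (intro lin_intros)
  finally show ?thesis .
qed

lemma S_mult_sw: "sw a (\<lambda>x y. S x * y) = ER a"
proof -
  have "sw a (\<lambda>x y. S x * y) = sweedler2 (\<Delta> a) (\<lambda>x y. S x * y)"
    by (rule sweedler2_comult[of scale, symmetric]) (intro lin_intros lin_S)
  also have "\<dots> = sweedler2 (\<Delta> 1) (\<lambda>x y. \<epsilon> (a * y) *s x)"
    using pre_antipode by (simp add: pre_antipode_def)
  also have "\<dots> = ER a"
    unfolding ER_def by (rule sweedler2_comult[of scale]) (intro lin_intros)
  finally show ?thesis .
qed

lemma sw_S:
  assumes F: "bilinear_map s F"
  shows "sw (S a) F = sw a (\<lambda>x y. F (S y) (S x))"
proof -
  have "sw (S a) F = sweedler2 (sweedler2 (\<Delta> a) (\<lambda>x y. tens2 (S y) (S x))) F"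
    using anti_morphism by (simp add: sweedler2_comult[OF F, symmetric] bialgebra_anti_morphism_def)
  also have "sweedler2 (\<Delta> a) (\<lambda>x y. tens2 (S y) (S x)) = sw a (\<lambda>x y. tens2 (S y) (S x))"
    by (rule sweedler2_comult[of tensor_scale])
      (intro lin_intros lin_S bilinear_lin[OF bilinear_map_tens2])
  finally show ?thesis
    by (simp add: sweedler2_sw[OF F] sweedler2_tens2[OF F] tens2_in)
qed

text \<open>Since \<open>S (1 * y) = S y * S 1\<close>, right multiplication by \<open>S 1\<close>
  fixes \<open>EL 1\<close>, which is \<open>1\<close>.\<close>

lemma S_one: "S 1 = 1"
proof -
  have "EL 1 * S 1 = sw 1 (\<lambda>x y. x * S (1 * y))"
    unfolding mult_S_sw[symmetric] sw_mult_left by (rule sw_cong) (simp only: S_mult mult.assoc mult_1_right)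
  then show ?thesis by (simp add: mult_S_sw EL_one)
qed

lemma sw_one_S:
  assumes "bilinear_map s F"
  shows "sw 1 F = sw 1 (\<lambda>x y. F (S y) (S x))"
  using sw_S[OF assms, of 1] by (simp add: S_one)

lemma EL_mult: "EL (a * b) = sw a (\<lambda>x y. x * EL b * S y)"
proof -
  have "EL (a * b) = sw a (\<lambda>x y. sw b (\<lambda>u v. x * u * S (y * v)))"
    unfolding mult_S_sw[symmetric] by (rule sw_mult[of scale]) (intro lin_intros lin_S)
  also have "\<dots> = sw a (\<lambda>x y. x * EL b * S y)"
    by (rule sw_cong) (simp only: mult_S_sw[symmetric, of b] sw_mult_left sw_mult_right S_mult mult.assoc)
  finally show ?thesis .
qed

lemma ER_mult: "ER (a * b) = sw b (\<lambda>x y. S x * ER a * y)"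
proof -
  have "ER (a * b) = sw a (\<lambda>x y. sw b (\<lambda>u v. S (x * u) * (y * v)))"
    unfolding S_mult_sw[symmetric] by (rule sw_mult[of scale]) (intro lin_intros lin_S)
  also have "\<dots> = sw b (\<lambda>u v. sw a (\<lambda>x y. S (x * u) * (y * v)))"
    by (rule sw_swap)
  also have "\<dots> = sw b (\<lambda>u v. S u * ER a * v)"
    by (rule sw_cong) (simp only: S_mult_sw[symmetric, of a] sw_mult_left sw_mult_right S_mult mult.assoc)
  finally show ?thesis .
qed

text \<open>Expanding \<open>\<Delta>(a\<^sub>1 S(a\<^sub>2))\<close> gives
  \<open>a\<^sub>1 S(a\<^sub>4) \<otimes> a\<^sub>2 S(a\<^sub>3)\<close>, whose inner pair forms
  \<open>EL\<close>.\<close>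

lemma comult_EL:
  assumes F: "bilinear_map s F"
  shows "sw (EL a) F = sw a (\<lambda>x y. sw y (\<lambda>p q. F (x * S q) (EL p)))"
proof -
  note L = bilinear_lin[OF F] lin_intros lin_S
  have lin: "lin s (\<lambda>x. sw x F)" by (intro L F)
  have "sw (EL a) F = sw a (\<lambda>x y. sw (x * S y) F)"
    unfolding mult_S_sw[symmetric] by (rule sw_linear[OF lin])
  also have "\<dots> = sw a (\<lambda>x y. sw x (\<lambda>p q. sw (S y) (\<lambda>u v. F (p * u) (q * v))))"
    by (rule sw_cong, rule sw_mult[OF F])
  also have "\<dots> = sw a (\<lambda>x y. sw x (\<lambda>p q. sw y (\<lambda>u v. F (p * S v) (q * S u))))"
    by (rule sw_cong, rule sw_cong, rule sw_S[of s]) (intro L)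
  also have "\<dots> = sw a (\<lambda>x y. sw y (\<lambda>p q. sw q (\<lambda>u v. F (x * S v) (p * S u))))"
    by (rule sw_coassoc[of s]) (intro L)
  also have "\<dots> = sw a (\<lambda>x y. sw y (\<lambda>p q. sw p (\<lambda>u v. F (x * S q) (u * S v))))"
    by (rule sw_cong, rule sw_coassoc[of s, symmetric]) (intro L)
  also have "\<dots> = sw a (\<lambda>x y. sw y (\<lambda>p q. F (x * S q) (EL p)))"
    by (rule sw_cong, rule sw_cong) (simp only: mult_S_sw[symmetric] bilinear_sw2[OF F])
  finally show ?thesis .
qed

text \<open>Here the expansion is
  \<open>S(a\<^sub>2) a\<^sub>3 \<otimes> S(a\<^sub>1) a\<^sub>4\<close>, whose inner pair forms
  \<open>ER\<close>.\<close>

lemma comult_ER: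
  assumes F: "bilinear_map s F"
  shows "sw (ER a) F = sw a (\<lambda>x y. sw y (\<lambda>p q. F (ER p) (S x * q)))"
proof -
  note L = bilinear_lin[OF F] lin_intros lin_S
  have lin: "lin s (\<lambda>x. sw x F)" by (intro L F)
  have "sw (ER a) F = sw a (\<lambda>x y. sw (S x * y) F)"
    unfolding S_mult_sw[symmetric] by (rule sw_linear[OF lin])
  also have "\<dots> = sw a (\<lambda>x y. sw (S x) (\<lambda>p q. sw y (\<lambda>u v. F (p * u) (q * v))))"
    by (rule sw_cong, rule sw_mult[OF F])
  also have "\<dots> = sw a (\<lambda>x y. sw x (\<lambda>p q. sw y (\<lambda>u v. F (S q * u) (S p * v))))"
    by (rule sw_cong, rule sw_S[of s]) (intro L)
  also have "\<dots> = sw a (\<lambda>x y. sw y (\<lambda>p q. sw q (\<lambda>u v. F (S p * u) (S x * v))))"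
    by (rule sw_coassoc[of s]) (intro L)
  also have "\<dots> = sw a (\<lambda>x y. sw y (\<lambda>p q. sw p (\<lambda>u v. F (S u * v) (S x * q))))"
    by (rule sw_cong, rule sw_coassoc[of s, symmetric]) (intro L)
  also have "\<dots> = sw a (\<lambda>x y. sw y (\<lambda>p q. F (ER p) (S x * q)))"
    by (rule sw_cong, rule sw_cong) (simp only: S_mult_sw[symmetric] bilinear_sw1[OF F])
  finally show ?thesis .
qed

text \<open>
  The elements of \<open>cop 1\<close> need not lie in \<open>A\<^sub>L\<close> or \<open>A\<^sub>R\<close>, but \<open>comult_EL\<close> and \<open>comult_ER\<close> at \<open>1\<close> provide a
  representation of \<open>\<Delta> 1\<close> with one leg in the range of \<open>EL\<close> or \<open>ER\<close>.
\<close>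

lemma sw_one_eqI_EL:
  assumes "bilinear_map s K" "bilinear_map s K'" "\<And>x c. K x (EL c) = K' x (EL c)"
  shows "sw 1 K = sw 1 K'"
  using comult_EL[OF assms(1), of 1] comult_EL[OF assms(2), of 1] by (simp add: EL_one assms(3))

lemma sw_one_eqI_ER:
  assumes "bilinear_map s K" "bilinear_map s K'" "\<And>y c. K (ER c) y = K' (ER c) y"
  shows "sw 1 K = sw 1 K'"
  using comult_ER[OF assms(1), of 1] comult_ER[OF assms(2), of 1] by (simp add: ER_one assms(3))

text \<open>A general \<open>\<phi>\<close> is handled by the representation of
  \<open>\<Delta> 1\<close> with second legs in the range of \<open>EL\<close>; the converse takes
  \<open>\<lambda>x. \<epsilon> (x * c)\<close> for \<open>\<phi>\<close>.\<close>

lemma A_L_eq: "A_L = range EL"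
proof (intro equalityI subsetI)
  fix a assume "a \<in> A_L"
  then obtain \<phi> where \<phi>: "lin (*) \<phi>" and a: "a = sweedler2 (\<Delta> 1) (\<lambda>x y. \<phi> x *s y)"
    by (auto simp: A_L_def linear_form_def)
  have bil: "bilinear_map scale (\<lambda>x y. \<phi> x *s y)" by (intro lin_intros \<phi>)
  have "a = sw (EL 1) (\<lambda>x y. \<phi> x *s y)"
    by (simp add: a sweedler2_comult[OF bil] EL_one)
  also have "\<dots> = sw 1 (\<lambda>x y. sw y (\<lambda>p q. \<phi> (x * S q) *s EL p))"
    by (rule comult_EL[OF bil])
  also have "\<dots> = EL (sw 1 (\<lambda>x y. sw y (\<lambda>p q. \<phi> (x * S q) *s p)))"
    using lin_EL[OF lin_ident] by (simp add: sw_linear[OF lin_EL[OF lin_ident]] Vector_Spaces.linear_iff)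
  finally show "a \<in> range EL" by blast
next
  fix a assume "a \<in> range EL"
  then obtain c where c: "a = EL c" by blast
  have "a = sweedler2 (\<Delta> 1) (\<lambda>x y. \<epsilon> (x * c) *s y)"
    unfolding c EL_def by (rule sweedler2_comult[of scale, symmetric]) (intro lin_intros)
  moreover have "linear_form (\<lambda>x. \<epsilon> (x * c))"
    unfolding linear_form_def by (intro lin_intros)
  ultimately show "a \<in> A_L"
    unfolding A_L_def by (intro CollectI exI[of _ "\<lambda>x. \<epsilon> (x * c)"] conjI)
qed

lemma A_R_eq: "A_R = range ER"
proof (intro equalityI subsetI)
  fix a assume "a \<in> A_R"
  then obtain \<phi> where \<phi>: "lin (*) \<phi>" and a: "a = sweedler2 (\<Delta> 1) (\<lambda>x y. \<phi> y *s x)"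
    by (auto simp: A_R_def linear_form_def)
  have bil: "bilinear_map scale (\<lambda>x y. \<phi> y *s x)" by (intro lin_intros \<phi>)
  have "a = sw (ER 1) (\<lambda>x y. \<phi> y *s x)"
    by (simp add: a sweedler2_comult[OF bil] ER_one)
  also have "\<dots> = sw 1 (\<lambda>x y. sw y (\<lambda>p q. \<phi> (S x * q) *s ER p))"
    by (rule comult_ER[OF bil])
  also have "\<dots> = ER (sw 1 (\<lambda>x y. sw y (\<lambda>p q. \<phi> (S x * q) *s p)))"
    using lin_ER[OF lin_ident] by (simp add: sw_linear[OF lin_ER[OF lin_ident]] Vector_Spaces.linear_iff)
  finally show "a \<in> range ER" by blast
next
  fix a assume "a \<in> range ER"
  then obtain c where c: "a = ER c" by blast
  have "a = sweedler2 (\<Delta> 1) (\<lambda>x y. \<epsilon> (c * y) *s x)"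
    unfolding c ER_def by (rule sweedler2_comult[of scale, symmetric]) (intro lin_intros)
  moreover have "linear_form (\<lambda>x. \<epsilon> (c * x))"
    unfolding linear_form_def by (intro lin_intros)
  ultimately show "a \<in> A_R"
    unfolding A_R_def by (intro CollectI exI[of _ "\<lambda>x. \<epsilon> (c * x)"] conjI)
qed

section \<open>Commuting subalgebras give the shift identity\<close>

lemma commuting_iff: "commuting (*) A_L A_R \<longleftrightarrow> (\<forall>a b. EL a * ER b = ER b * EL a)"
  by (auto simp: commuting_def A_L_eq A_R_eq)

lemma commuting_EL_shift:
  assumes comm: "\<And>a b. EL a * ER b = ER b * EL a"
  shows EL_shift
proof -
  note L = lin_intros lin_S lin_EL lin_ER
  \<comment> \<open>Commutation puts \<open>ER y\<close> between \<open>S(x\<^sub>2)\<close> and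
    \<open>x\<^sub>3\<close>, where \<open>ER_mult\<close> merges these three factors into
    \<open>ER\<close> of \<open>y\<close> times one leg of \<open>x\<close>; its
    \<open>\<Delta> 1\<close> is then absorbed.\<close>
  have ER_mult_eq: "sw x (\<lambda>u v. \<epsilon> (y * v) *s u) = ER y * x" for x y
  proof -
    have "ER y * x = sw x (\<lambda>u v. ER y * (EL u * v))"
      by (subst (1) EL_mult_sw[of x, symmetric]) (rule sw_mult_right)
    also have "\<dots> = sw x (\<lambda>u v. sw u (\<lambda>p q. p * S q * (ER y * v)))"
      by (rule sw_cong)
        (simp only: mult.assoc[symmetric] comm[symmetric], simp only: mult_S_sw[symmetric] sw_mult_left)
    also have "\<dots> = sw x (\<lambda>p q. sw q (\<lambda>u v. p * S u * (ER y * v)))"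
      by (rule sw_coassoc[of scale]) (intro L)
    also have "\<dots> = sw x (\<lambda>p q. p * ER (y * q))"
      by (rule sw_cong) (simp only: ER_mult sw_mult_right mult.assoc)
    also have "\<dots> = sw x (\<lambda>p q. sw 1 (\<lambda>u v. \<epsilon> (y * (q * v)) *s (p * u)))"
      by (rule sw_cong) (simp only: ER_def sw_mult_right scale_mult_right mult.assoc)
    also have "\<dots> = sw 1 (\<lambda>u v. sw x (\<lambda>p q. \<epsilon> (y * (q * v)) *s (p * u)))"
      by (rule sw_swap)
    also have "\<dots> = sw x (\<lambda>u v. \<epsilon> (y * v) *s u)"
      by (rule sw_mult_one[of scale "\<lambda>u v. \<epsilon> (y * v) *s u"]) (intro L)
    finally show ?thesis by simp
  qed
  have counit_ER_mult: "\<epsilon> (ER y * x) = \<epsilon> (y * x)" for x y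
  proof -
    have "\<epsilon> (ER y * x) = sw x (\<lambda>u v. \<epsilon> u * \<epsilon> (y * v))"
      unfolding ER_mult_eq[symmetric] counit_sw counit_scale by (rule sw_cong) (rule mult.commute)
    also have "\<dots> = \<epsilon> (y * x)"
      by (rule sw_counit_left) (intro L)
    finally show ?thesis .
  qed
  have ER_idem: "ER (ER y) = ER y" for y
    unfolding ER_def[of "ER y"] counit_ER_mult by (rule ER_def[symmetric])
  have "sw a (\<lambda>x y. tens2 x (EL y)) = sw 1 (\<lambda>x y. tens2 (x * a) y)" for a
  proof -
    note B = bilinear_map_tens2
    note L = bilinear_lin[OF B] L
    have "sw a (\<lambda>x y. tens2 x (EL y)) =
        sw a (\<lambda>x y. sw 1 (\<lambda>u v. tens2 (\<epsilon> (u * y) *s x) v))"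
      by (rule sw_cong)
        (simp only: EL_def bilinear_sw2[OF B] bilinear_scale1[OF B] bilinear_scale2[OF B])
    also have "\<dots> = sw 1 (\<lambda>u v. sw a (\<lambda>x y. tens2 (\<epsilon> (u * y) *s x) v))"
      by (rule sw_swap)
    also have "\<dots> = sw 1 (\<lambda>u v. tens2 (ER u * a) v)"
      by (rule sw_cong) (simp only: ER_mult_eq[symmetric] bilinear_sw1[OF B])
    \<comment> \<open>The first leg \<open>u\<close> may be taken in the range of \<open>ER\<close>,
      where idempotence erases \<open>ER\<close>.\<close>
    also have "\<dots> = sw 1 (\<lambda>u v. tens2 (u * a) v)"
      by (rule sw_one_eqI_ER[of tensor_scale]) (intro L, intro L, simp only: ER_idem)
    finally show ?thesis .
  qed
  then show ?thesis by (simp add: EL_shift_def)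
qed

lemma commuting_dual_EL_shift:
  assumes comm: "\<And>a b c. sw b (\<lambda>x y. \<epsilon> (a * x) * \<epsilon> (y * c)) = sw b (\<lambda>x y. \<epsilon> (a * y) * \<epsilon> (x * c))"
  shows EL_shift
proof -
  note B = bilinear_map_tens2
  note L = bilinear_lin[OF B] lin_intros lin_S lin_EL lin_ER
  \<comment> \<open>Both sides expand over two copies of \<open>\<Delta> 1\<close>; \<open>b\<close>
    enters only through scalar coefficients, which are values of the two products in the dual
    algebra.\<close>
  have ER_EL: "sw b (\<lambda>p q. G (ER q) (EL p)) = sw b (\<lambda>p q. G (ER p) (EL q))"
    if G: "bilinear_map s G" for s :: "'k \<Rightarrow> 'b::ab_group_add \<Rightarrow> 'b" and G b
  proof -
    interpret s: vector_space s using G by (rule bilinear_vector_space)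
    have expand: "G (ER q) (EL p) =
        sw 1 (\<lambda>u v. sw 1 (\<lambda>u' v'. s (\<epsilon> (q * v) * \<epsilon> (u' * p)) (G u v')))" for p q
    proof -
      have "G (ER q) (EL p) = sw 1 (\<lambda>u v. s (\<epsilon> (q * v)) (G u (EL p)))"
        by (simp only: ER_def bilinear_sw1[OF G] bilinear_scale1[OF G])
      also have "\<dots> = sw 1 (\<lambda>u v. sw 1 (\<lambda>u' v'. s (\<epsilon> (q * v) * \<epsilon> (u' * p)) (G u v')))"
        by (rule sw_cong) (simp only: EL_def bilinear_sw2[OF G] bilinear_scale2[OF G]
            sw_scale[OF s.vector_space_axioms] s.scale_scale)
      finally show ?thesis .
    qed
    have pull: "sw b (\<lambda>p q. s (f p q) w) = s (sw b f) w" for f w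
      by (rule sw_linear[of "(*)" s, symmetric])
        (simp add: Vector_Spaces.linear_iff vector_space_field s.vector_space_axioms
          s.scale_left_distrib)
    have ER_EL_sum: "sw b (\<lambda>p q. G (ER (f p q)) (EL (g p q))) = sw 1 (\<lambda>u v. sw 1 (\<lambda>u' v'.
        s (sw b (\<lambda>p q. \<epsilon> (f p q * v) * \<epsilon> (u' * g p q))) (G u v')))" for f g
    proof -
      have "sw b (\<lambda>p q. G (ER (f p q)) (EL (g p q))) = sw b (\<lambda>p q. sw 1 (\<lambda>u v. sw 1 (\<lambda>u' v'.
          s (\<epsilon> (f p q * v) * \<epsilon> (u' * g p q)) (G u v'))))"
        by (rule sw_cong, rule expand)
      also have "\<dots> = sw 1 (\<lambda>u v. sw b (\<lambda>p q. sw 1 (\<lambda>u' v'.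
          s (\<epsilon> (f p q * v) * \<epsilon> (u' * g p q)) (G u v'))))"
        by (rule sw_swap)
      also have "\<dots> = sw 1 (\<lambda>u v. sw 1 (\<lambda>u' v'. sw b (\<lambda>p q.
          s (\<epsilon> (f p q * v) * \<epsilon> (u' * g p q)) (G u v'))))"
        by (rule sw_cong, rule sw_swap)
      finally show ?thesis by (simp only: pull)
    qed
    have "sw b (\<lambda>p q. \<epsilon> (q * v) * \<epsilon> (u * p)) = sw b (\<lambda>p q. \<epsilon> (p * v) * \<epsilon> (u * q))" for u v
      using comm[of b u v] by (simp only: mult.commute)
    then show ?thesis by (simp only: ER_EL_sum)
  qed
  have "sw a (\<lambda>x y. tens2 x (EL y)) = sw 1 (\<lambda>x y. tens2 (x * a) y)" for a
  proof -
    \<comment> \<open>Inserting the counit into the first leg creates \<open>\<epsilon>(1\<^sub>1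
      a\<^sub>1) 1\<^sub>2 a\<^sub>2 \<otimes> 1\<^sub>3\<close>, in which the coproduct of
      \<open>EL(a\<^sub>1)\<close> becomes visible.\<close>
    have "sw 1 (\<lambda>u v. tens2 (u * a) v) =
        sw 1 (\<lambda>u v. sw (u * a) (\<lambda>p q. tensor_scale (\<epsilon> p) (tens2 q v)))"
      by (rule sw_cong, rule sw_counit_left[symmetric]) (intro L)
    also have "\<dots> = sw 1 (\<lambda>u v. sw u (\<lambda>p q. sw a (\<lambda>x y. tensor_scale (\<epsilon> (p * x)) (tens2 (q * y) v))))"
      by (rule sw_cong, rule sw_mult[of tensor_scale]) (intro L)
    also have "\<dots> = sw 1 (\<lambda>u v. sw v (\<lambda>p q. sw a (\<lambda>x y. tensor_scale (\<epsilon> (u * x)) (tens2 (p * y) q))))"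
      by (rule sw_coassoc[of tensor_scale]) (intro L)
    also have "\<dots> = sw 1 (\<lambda>u v. sw a (\<lambda>x y. sw v (\<lambda>p q. tensor_scale (\<epsilon> (u * x)) (tens2 (p * y) q))))"
      by (rule sw_cong, rule sw_swap)
    also have "\<dots> = sw a (\<lambda>x y. sw 1 (\<lambda>u v. sw v (\<lambda>p q. tensor_scale (\<epsilon> (u * x)) (tens2 (p * y) q))))"
      by (rule sw_swap)
    also have "\<dots> = sw a (\<lambda>x y. sw (EL x) (\<lambda>p q. tens2 (p * y) q))"
    proof (rule sw_cong)
      fix x y
      have bil: "bilinear_map tensor_scale (\<lambda>p q. tens2 (p * y) q)" by (intro L)
      show "sw 1 (\<lambda>u v. sw v (\<lambda>p q. tensor_scale (\<epsilon> (u * x)) (tens2 (p * y) q))) =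
          sw (EL x) (\<lambda>p q. tens2 (p * y) q)"
        by (simp only: sw_EL[OF bil] sw_scale[OF vector_space_tensor_scale])
    qed
    also have "\<dots> = sw a (\<lambda>x y. sw x (\<lambda>p q. sw q (\<lambda>u v. tens2 (p * S v * y) (EL u))))"
      by (rule sw_cong, rule comult_EL[of tensor_scale]) (intro L)
    also have "\<dots> = sw a (\<lambda>x y. sw y (\<lambda>p q. sw p (\<lambda>u v. tens2 (x * S v * q) (EL u))))"
      by (rule sw_coassoc[of tensor_scale]) (intro L)
    also have "\<dots> = sw a (\<lambda>x y. sw y (\<lambda>p q. sw q (\<lambda>u v. tens2 (x * S u * v) (EL p))))"
      by (rule sw_cong, rule sw_coassoc[of tensor_scale]) (intro L)
    also have "\<dots> = sw a (\<lambda>x y. sw y (\<lambda>p q. tens2 (x * ER q) (EL p)))"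
      by (rule sw_cong, rule sw_cong)
        (simp only: S_mult_sw[symmetric] sw_mult_right bilinear_sw1[OF B] mult.assoc)
    also have "\<dots> = sw a (\<lambda>x y. sw y (\<lambda>p q. tens2 (x * ER p) (EL q)))"
      by (rule sw_cong, rule ER_EL[of tensor_scale]) (intro L)
    \<comment> \<open>After the exchange \<open>ER\<close> sits on the leg next to \<open>x\<close>,
      so coassociativity and \<open>mult_ER_sw\<close> contract the two.\<close>
    also have "\<dots> = sw a (\<lambda>x y. sw x (\<lambda>p q. tens2 (p * ER q) (EL y)))"
      by (rule sw_coassoc[of tensor_scale, symmetric]) (intro L)
    also have "\<dots> = sw a (\<lambda>x y. tens2 x (EL y))"
      by (rule sw_cong, subst bilinear_sw1[OF B, symmetric]) (simp only: mult_ER_sw)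
    finally show ?thesis by simp
  qed
  then show ?thesis by (simp add: EL_shift_def)
qed

section \<open>Consequences of right comonoidality\<close>

context
  assumes rc: right_comonoidal
begin

text \<open>Right comonoidality rewrites
  \<open>\<epsilon>(1\<^sub>1 c) 1\<^sub>2 \<otimes> 1\<^sub>3\<close> as
  \<open>\<epsilon>(1\<^sub>1 c) 1'\<^sub>1 1\<^sub>2 \<otimes> 1'\<^sub>2\<close>, where
  \<open>EL c\<close> reappears.\<close>

lemma comult_EL_rc:
  assumes F: "bilinear_map s F"
  shows "sw (EL c) F = sw 1 (\<lambda>u v. F (u * EL c) v)"
proof -
  note L = bilinear_lin[OF F] lin_intros
  have "sw (EL c) F = sw 1 (\<lambda>x y. sw y (\<lambda>u v. s (\<epsilon> (x * c)) (F u v)))"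
    by (simp only: sw_EL[OF F] sw_scale[OF bilinear_vector_space[OF F]])
  also have "\<dots> = sw 1 (\<lambda>x y. sw x (\<lambda>u v. s (\<epsilon> (u * c)) (F v y)))"
    by (rule sw_coassoc[of s, symmetric]) (intro L)
  also have "\<dots> = sw 1 (\<lambda>x y. sw 1 (\<lambda>u v. s (\<epsilon> (x * c)) (F (u * y) v)))"
    by (rule right_comonoidalD[OF rc, of s, symmetric]) (intro L)
  also have "\<dots> = sw 1 (\<lambda>u v. sw 1 (\<lambda>x y. s (\<epsilon> (x * c)) (F (u * y) v)))"
    by (rule sw_swap)
  also have "\<dots> = sw 1 (\<lambda>u v. F (u * EL c) v)"
    by (rule sw_cong)
      (simp only: EL_def sw_mult_right scale_mult_right bilinear_sw1[OF F] bilinear_scale1[OF F])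
  finally show ?thesis .
qed

lemma comult_mult_EL:
  assumes F: "bilinear_map s F"
  shows "sw (x * EL c) F = sw x (\<lambda>p q. F (p * EL c) q)"
proof -
  note L = bilinear_lin[OF F] lin_intros
  have "sw (x * EL c) F = sw x (\<lambda>p q. sw (EL c) (\<lambda>u v. F (p * u) (q * v)))"
    by (rule sw_mult[OF F])
  also have "\<dots> = sw x (\<lambda>p q. sw 1 (\<lambda>u v. F (p * (u * EL c)) (q * v)))"
    by (rule sw_cong, rule comult_EL_rc[of s]) (intro L)
  also have "\<dots> = sw 1 (\<lambda>u v. sw x (\<lambda>p q. F (p * u * EL c) (q * v)))"
    unfolding mult.assoc by (rule sw_swap)
  also have "\<dots> = sw x (\<lambda>p q. F (p * EL c) q)"
    by (rule sw_mult_one[of s "\<lambda>p q. F (p * EL c) q"]) (intro L)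
  finally show ?thesis .
qed

lemma ER_mult_EL: "ER (x * EL c) = S (EL c) * ER x"
proof -
  have "ER (x * EL c) = sw x (\<lambda>p q. S (p * EL c) * q)"
    unfolding S_mult_sw[symmetric] by (rule comult_mult_EL[of scale]) (intro lin_intros lin_S)
  also have "\<dots> = S (EL c) * ER x"
    unfolding S_mult_sw[symmetric] sw_mult_right S_mult mult.assoc ..
  finally show ?thesis .
qed

text \<open>With \<open>l = EL c\<close>, both sides equal
  \<open>ER(l\<^sub>1) \<otimes> l\<^sub>2\<close>: the left by the \<open>ER\<close> shift, the
  right by \<open>comult_EL_rc\<close>, \<open>ER_mult_EL\<close> and the \<open>ER\<close> shift at
  \<open>1\<close>.\<close>

lemma one_EL_mult:
  assumes F: "bilinear_map s F"
  shows "sw 1 (\<lambda>u v. F u (EL c * v)) = sw 1 (\<lambda>u v. F (S (EL c) * u) v)"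
proof -
  note L = bilinear_lin[OF F] lin_intros lin_ER
  have "sw 1 (\<lambda>u v. F u (EL c * v)) = sw (EL c) (\<lambda>x y. F (ER x) y)"
    by (rule right_comonoidal_ER_shift[OF rc F, symmetric])
  also have "\<dots> = sw 1 (\<lambda>u v. F (S (EL c) * ER u) v)"
    unfolding ER_mult_EL[symmetric] by (rule comult_EL_rc[of s]) (intro L)
  also have "\<dots> = sw 1 (\<lambda>u v. F (S (EL c) * u) (1 * v))"
    by (rule right_comonoidal_ER_shift[OF rc, of s]) (intro L)
  finally show ?thesis by simp
qed

lemma EL_idem_rc: "EL (EL a) = EL a"
  using rc by (intro EL_idem right_comonoidal_EL_shift)

lemma one_mult_EL:
  assumes F: "bilinear_map s F"
  shows "sw 1 (\<lambda>u v. F (u * EL c) v) = sw 1 (\<lambda>u v. F (EL c * u) v)"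
proof -
  note L = bilinear_lin[OF F] lin_intros lin_S
  have "sw 1 (\<lambda>u v. F (u * EL c) v) = sw (EL c * 1) F"
    by (simp add: comult_EL_rc[OF F])
  also have "\<dots> = sw (EL c) (\<lambda>x y. sw 1 (\<lambda>p q. F (x * p) (y * q)))"
    by (rule sw_mult[OF F])
  also have "\<dots> = sw 1 (\<lambda>u v. sw 1 (\<lambda>p q. F (u * EL c * p) (v * q)))"
    by (rule comult_EL_rc[of s]) (intro L)
  \<comment> \<open>\<open>one_EL_mult\<close> needs a factor from the range of \<open>EL\<close>;
    \<open>sw_one_eqI_EL\<close> permits replacing \<open>v\<close> by such an element.\<close>
  also have "\<dots> = sw 1 (\<lambda>u v. sw 1 (\<lambda>p q. F (u * EL c * (S v * p)) q))"
    by (rule sw_one_eqI_EL[of s]) (intro L, intro L, rule one_EL_mult[of s], intro L)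
  also have "\<dots> = sw 1 (\<lambda>p q. sw 1 (\<lambda>u v. F (u * EL c * (S v * p)) q))"
    by (rule sw_swap)
  also have "\<dots> = sw 1 (\<lambda>p q. F (EL c * p) q)"
  proof (rule sw_cong)
    fix p q
    \<comment> \<open>By idempotence \<open>EL c\<close> is \<open>x * S y\<close> summed over its
      own coproduct, which \<open>comult_EL_rc\<close> expresses through
      \<open>\<Delta> 1\<close>.\<close>
    have "EL c = sw (EL c) (\<lambda>x y. x * S y)"
      by (simp only: mult_S_sw EL_idem_rc)
    also have "\<dots> = sw 1 (\<lambda>u v. u * EL c * S v)"
      by (rule comult_EL_rc[of scale]) (intro L)
    finally have "F (EL c * p) q = F (sw 1 (\<lambda>u v. u * EL c * S v) * p) q" by simp
    then show "sw 1 (\<lambda>u v. F (u * EL c * (S v * p)) q) = F (EL c * p) q"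
      by (simp only: sw_mult_left bilinear_sw1[OF F] mult.assoc)
  qed
  finally show ?thesis .
qed

lemma EL_ER_commute: "EL a * ER b = ER b * EL a"
proof -
  have "EL a * ER b = sw 1 (\<lambda>u v. \<epsilon> (b * v) *s (EL a * u))"
    by (simp only: ER_def sw_mult_right scale_mult_right)
  also have "\<dots> = sw 1 (\<lambda>u v. \<epsilon> (b * v) *s (u * EL a))"
    by (rule one_mult_EL[of scale "\<lambda>u v. \<epsilon> (b * v) *s u", symmetric]) (intro lin_intros)
  also have "\<dots> = ER b * EL a"
    by (simp only: ER_def sw_mult_left scale_mult_left)
  finally show ?thesis .
qed

text \<open>The two products differ only in the order of the middle factors, which may be taken from
  the ranges of \<open>EL\<close> and \<open>ER\<close>.\<close>

lemma left_comonoidal_rc: left_comonoidal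
proof -
  note L = lin_intros trilinear_lin[OF trilinear_map_tens3]
  have "sw 1 (\<lambda>x y. sw 1 (\<lambda>u v. tens3 x (y * u) v)) = sw 1 (\<lambda>x y. sw 1 (\<lambda>u v. tens3 x (u * y) v))"
    by (rule sw_one_eqI_EL[of tensor_scale], intro L, intro L,
        rule sw_one_eqI_ER[of tensor_scale], intro L, intro L) (simp only: EL_ER_commute)
  then show ?thesis using rc unfolding right_comonoidal_iff left_comonoidal_iff by simp
qed

text \<open>By \<open>EL_mult\<close>, \<open>EL (x * b)\<close> depends on \<open>b\<close> only
  through \<open>EL b\<close>.\<close>

lemma EL_mult_EL: "EL (x * EL y) = EL (x * y)"
  by (simp only: EL_mult EL_idem_rc)

lemma counit_mult_EL: "\<epsilon> (x * EL y) = \<epsilon> (x * y)"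
  using counit_EL[of "x * EL y"] counit_EL[of "x * y"] by (simp add: EL_mult_EL)

text \<open>The counit sees \<open>y\<close> only through \<open>EL y\<close>, so the shift identity
  collects \<open>b\<close> in the other leg and leaves
  \<open>\<epsilon> (a * EL (b * c))\<close>.\<close>

lemma right_monoidal_rc: right_monoidal
  unfolding monoidal_iff
proof (intro allI)
  fix a b c
  have "sw b (\<lambda>x y. \<epsilon> (a * y) * \<epsilon> (x * c)) = sw b (\<lambda>x y. \<epsilon> (a * EL y) * \<epsilon> (x * c))"
    by (simp only: counit_mult_EL)
  also have "\<dots> = sw 1 (\<lambda>x y. \<epsilon> (a * y) * \<epsilon> (x * b * c))"
    by (rule EL_shiftD[OF right_comonoidal_EL_shift[OF rc], of "(*)"]) (intro lin_intros)
  also have "\<dots> = \<epsilon> (a * EL (b * c))"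
    unfolding EL_def sw_mult_right scale_mult_right counit_sw counit_scale mult.assoc
    by (rule sw_cong) (rule mult.commute)
  finally show "\<epsilon> (a * b * c) = sw b (\<lambda>x y. \<epsilon> (a * y) * \<epsilon> (x * c))"
    by (simp only: counit_mult_EL mult.assoc)
qed

lemma comult_ER_rc:
  assumes F: "bilinear_map s F"
  shows "sw (ER c) F = sw 1 (\<lambda>u v. F u (ER c * v))"
proof -
  note L = bilinear_lin[OF F] lin_intros
  have "sw (ER c) F = sw 1 (\<lambda>x y. sw x (\<lambda>u v. s (\<epsilon> (c * y)) (F u v)))"
    by (simp only: sw_ER[OF F] sw_scale[OF bilinear_vector_space[OF F]])
  also have "\<dots> = sw 1 (\<lambda>x y. sw 1 (\<lambda>u v. s (\<epsilon> (c * v)) (F x (u * y))))"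
    by (rule right_comonoidalD[OF rc, of s, symmetric]) (intro L)
  also have "\<dots> = sw 1 (\<lambda>x y. F x (ER c * y))"
    by (rule sw_cong)
      (simp only: ER_def sw_mult_left scale_mult_left bilinear_sw2[OF F] bilinear_scale2[OF F])
  finally show ?thesis .
qed

text \<open>\<open>comult_ER_rc\<close> leaves \<open>ER c\<close> to the left of the second leg;
  only after commuting past that leg, taken in the range of \<open>EL\<close>, can
  \<open>\<Delta> 1\<close> be absorbed into \<open>\<Delta> x\<close>.\<close>

lemma comult_mult_ER:
  assumes F: "bilinear_map s F"
  shows "sw (x * ER c) F = sw x (\<lambda>p q. F p (q * ER c))"
proof -
  note L = bilinear_lin[OF F] lin_intros
  have "sw (x * ER c) F = sw x (\<lambda>p q. sw (ER c) (\<lambda>u v. F (p * u) (q * v)))"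
    by (rule sw_mult[OF F])
  also have "\<dots> = sw x (\<lambda>p q. sw 1 (\<lambda>u v. F (p * u) (q * (ER c * v))))"
    by (rule sw_cong, rule comult_ER_rc[of s]) (intro L)
  also have "\<dots> = sw x (\<lambda>p q. sw 1 (\<lambda>u v. F (p * u) (q * (v * ER c))))"
    by (rule sw_cong, rule sw_one_eqI_EL[of s]) (intro L, intro L, simp only: EL_ER_commute)
  also have "\<dots> = sw 1 (\<lambda>u v. sw x (\<lambda>p q. F (p * u) (q * v * ER c)))"
    unfolding mult.assoc by (rule sw_swap)
  also have "\<dots> = sw x (\<lambda>p q. F p (q * ER c))"
    by (rule sw_mult_one[of s "\<lambda>p q. F p (q * ER c)"]) (intro L)
  finally show ?thesis .
qed

lemma EL_ER: "EL (ER c) = S (ER c)"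
proof -
  have "EL (ER c) = sw 1 (\<lambda>u v. u * S (ER c * v))"
    unfolding mult_S_sw[symmetric] by (rule comult_ER_rc[of scale]) (intro lin_intros lin_S)
  also have "\<dots> = EL 1 * S (ER c)"
    unfolding mult_S_sw[symmetric] sw_mult_left S_mult mult.assoc ..
  finally show ?thesis by (simp add: EL_one)
qed

text \<open>Applying \<open>\<lambda>y. \<epsilon> (S y * c)\<close> to the second leg of
  \<open>\<Delta> 1\<close> gives some \<open>r\<close> in \<open>A_R\<close>. As
  \<open>\<Delta> 1\<close> is invariant under \<open>S\<close> with legs exchanged,
  \<open>S r = EL c\<close>, and \<open>EL_ER\<close> identifies \<open>S r\<close> with
  \<open>EL r\<close>.\<close>

lemma ex_EL_ER: "\<exists>d. EL (ER d) = EL c"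
proof -
  have bil: "bilinear_map scale (\<lambda>x y. \<epsilon> (x * c) *s y)" by (intro lin_intros)
  have "linear_form (\<lambda>y. \<epsilon> (S y * c))"
    unfolding linear_form_def by (intro lin_intros lin_S)
  moreover have "sweedler2 (\<Delta> 1) (\<lambda>x y. \<epsilon> (S y * c) *s x) = sw 1 (\<lambda>x y. \<epsilon> (S y * c) *s x)"
    by (rule sweedler2_comult[of scale]) (intro lin_intros lin_S)
  ultimately have "sw 1 (\<lambda>x y. \<epsilon> (S y * c) *s x) \<in> range ER"
    unfolding A_R_eq[symmetric] A_R_def by force
  then obtain d where d: "ER d = sw 1 (\<lambda>x y. \<epsilon> (S y * c) *s x)" by force
  have "EL (ER d) = S (ER d)" by (rule EL_ER)
  also have "\<dots> = sw 1 (\<lambda>x y. \<epsilon> (S y * c) *s S x)"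
    using lin_S[OF lin_ident] by (simp add: d sw_linear[OF lin_S[OF lin_ident]] Vector_Spaces.linear_iff)
  also have "\<dots> = EL c"
    unfolding EL_def by (rule sw_one_S[OF bil, symmetric])
  finally show ?thesis by blast
qed

lemma left_monoidal_rc: left_monoidal
  unfolding monoidal_iff
proof (intro allI)
  fix a b c
  obtain d where d: "EL (ER d) = EL c" using ex_EL_ER by blast
  \<comment> \<open>The value \<open>\<epsilon> (x * c)\<close> depends on \<open>c\<close> only
    through \<open>EL c\<close>, so \<open>ER d\<close> can stand in for \<open>c\<close>.\<close>
  have eq: "\<epsilon> (x * ER d) = \<epsilon> (x * c)" for x
    using counit_mult_EL[of x "ER d"] counit_mult_EL[of x c] by (simp add: d)
  have "sw b (\<lambda>x y. \<epsilon> (a * x) * \<epsilon> (y * c)) = sw b (\<lambda>x y. \<epsilon> (y * ER d) * \<epsilon> (a * x))"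
    by (rule sw_cong) (simp only: eq mult.commute)
  also have "\<dots> = sw (b * ER d) (\<lambda>x y. \<epsilon> y * \<epsilon> (a * x))"
    by (rule comult_mult_ER[of "(*)", symmetric]) (intro lin_intros)
  also have "\<dots> = \<epsilon> (a * (b * ER d))"
    by (rule sw_counit_right) (intro lin_intros)
  also have "\<dots> = \<epsilon> (a * b * c)"
    by (simp only: mult.assoc[symmetric] eq)
  finally show "\<epsilon> (a * b * c) = sw b (\<lambda>x y. \<epsilon> (a * x) * \<epsilon> (y * c))" by simp
qed

text \<open>The shift identity turns \<open>S(a\<^sub>1) EL(a\<^sub>2)\<close> into
  \<open>S(1\<^sub>1 a) 1\<^sub>2 = S(a) S(1\<^sub>1) 1\<^sub>2\<close>, and the last two factors
  give \<open>ER 1\<close>, which is \<open>1\<close>.\<close>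

lemma antipode_rc: "antipode S"
proof -
  note L = lin_intros lin_S
  have "sweedler3 (comult3 a) (\<lambda>a1 a2 a3. S a1 * a2 * S a3) = S a" for a
  proof -
    have tri: "trilinear_map scale (\<lambda>a1 a2 a3. S a1 * a2 * S a3)" by (intro L)
    have "sweedler3 (comult3 a) (\<lambda>a1 a2 a3. S a1 * a2 * S a3) =
        sw a (\<lambda>x y. sw x (\<lambda>u v. S u * v * S y))"
      by (simp add: comult3_eq_sw sweedler3_sw[OF tri] sweedler3_tens3[OF tri]
          sw_tensor_space3 tens3_in)
    also have "\<dots> = sw a (\<lambda>x y. sw y (\<lambda>u v. S x * u * S v))"
      by (rule sw_coassoc[OF tri])
    also have "\<dots> = sw a (\<lambda>x y. S x * EL y)"
      by (rule sw_cong) (simp only: mult_S_sw[symmetric] sw_mult_right mult.assoc)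
    also have "\<dots> = sw 1 (\<lambda>x y. S (x * a) * y)"
      by (rule EL_shiftD[OF right_comonoidal_EL_shift[OF rc], of scale]) (intro L)
    also have "\<dots> = S a * ER 1"
      by (simp only: S_mult_sw[symmetric] sw_mult_right S_mult mult.assoc)
    finally show ?thesis by (simp add: ER_one)
  qed
  then show ?thesis using pre_antipode by (simp add: antipode_def)
qed

end

section \<open>Reduction of all conditions to right comonoidality\<close>

lemma bimonoidal_iff_right_comonoidal: "bimonoidal \<longleftrightarrow> right_comonoidal"
  using left_monoidal_rc right_monoidal_rc left_comonoidal_rc by (auto simp: bimonoidal_def)

lemma commuting_iff_right_comonoidal: "commuting (*) A_L A_R \<longleftrightarrow> right_comonoidal"
  using EL_ER_commute EL_shift_right_comonoidal[OF commuting_EL_shift]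
  by (auto simp: commuting_iff)

lemma commuting_dual_iff_right_comonoidal:
  "commuting dual_mult dual_L dual_R \<longleftrightarrow> right_comonoidal"
proof
  assume "commuting dual_mult dual_L dual_R"
  then show right_comonoidal
    unfolding commuting_dual_iff by (intro EL_shift_right_comonoidal commuting_dual_EL_shift) blast
next
  assume rc: right_comonoidal
  \<comment> \<open>Left and right monoidality evaluate the two dual products to the same
    \<open>\<epsilon> (a * b * c)\<close>.\<close>
  then show "commuting dual_mult dual_L dual_R"
    using left_monoidal_rc[OF rc] right_monoidal_rc[OF rc]
    unfolding commuting_dual_iff monoidal_iff by metis
qed

end

theorem theorem8p6:
  fixes scale :: "'k::field \<Rightarrow> 'a::{ring, monoid_mult} \<Rightarrow> 'a"
    and \<Delta> :: "'a \<Rightarrow> ('k, 'a) tensor2"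
    and \<epsilon> :: "'a \<Rightarrow> 'k"
    and S :: "'a \<Rightarrow> 'a"
  assumes "weak_bialgebra scale \<Delta> \<epsilon>"
    and "weak_bialgebra.pre_antipode scale \<Delta> \<epsilon> S"
    and "weak_bialgebra.bialgebra_anti_morphism scale \<Delta> S"
  shows
    "((weak_bialgebra.antipode scale \<Delta> \<epsilon> S \<and> weak_bialgebra.weak_hopf_algebra scale \<Delta> \<epsilon>)
        \<longleftrightarrow> weak_bialgebra.bimonoidal scale \<Delta> \<epsilon>) \<and>
     (weak_bialgebra.bimonoidal scale \<Delta> \<epsilon>
        \<longleftrightarrow> (weak_bialgebra.right_monoidal scale \<Delta> \<epsilon> \<and> weak_bialgebra.right_comonoidal scale \<Delta>)) \<and>
     (weak_bialgebra.bimonoidal scale \<Delta> \<epsilon>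
        \<longleftrightarrow> commuting (*) (weak_bialgebra.A_L scale \<Delta>) (weak_bialgebra.A_R scale \<Delta>)) \<and>
     (weak_bialgebra.bimonoidal scale \<Delta> \<epsilon>
        \<longleftrightarrow> commuting (weak_bialgebra.dual_mult scale \<Delta>)
              (weak_bialgebra.dual_L \<epsilon>) (weak_bialgebra.dual_R \<epsilon>))"
proof -
  interpret antimorphic_preantipode scale \<Delta> \<epsilon> S
    using assms by (simp add: antimorphic_preantipode_def antimorphic_preantipode_axioms_def)
  \<comment> \<open>After rewriting, every statement is right comonoidality, possibly joined with
    the antipode property or right monoidality, which it implies.\<close>
  show ?thesis
    using antipode_rc right_monoidal_rc
    by (auto simp: commuting_iff_right_comonoidal commuting_dual_iff_right_comonoidal
        bimonoidal_iff_right_comonoidal weak_hopf_algebra_def)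
qed

end
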